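(* For every $\gamma\in[0,1/2]$, the policy $\mathsf{ATT}(\gamma)$ satisfies: (1) on every instance of MP-KHD, $\mathbb{E}[\text{profit of }\mathsf{ATT}(\gamma)]\ge \gamma\cdot \mathrm{OPT\text{-}OFF}$ (competitive ratio at least $\gamma$); (2) on every instance, the total number $H$ of successful assignments made by $\mathsf{ATT}(\gamma)$ satisfies $\mathrm{Var}[H]\le \gamma(1-\gamma)B$, where $B=\sum_{i\in I}b_i$; (3) $\mathsf{ATT}(1/2)$ has the optimal competitive ratio $1/2$: it achieves competitive ratio $1/2$, and for every $\rho>1/2$ no online policy achieves competitive ratio $\rho$ on all instances of MP-KHD. Moreover both bounds are tight, measured directly against $\mathrm{OPT\text{-}OFF}$ (not against the LP value): there is an instance with $\mathbb{E}[\text{profit of }\mathsf{ATT}(\gamma)]=\gamma\cdot\mathrm{OPT\text{-}OFF}$ for every $\gamma\in[0,1/2]$, and for every positive integer $B$ there is an instance with $\sum_i b_i=B$ on which $\mathrm{Var}[H]=\gamma(1-\gamma)B$ for every $\gamma\in[0,1/2]$.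
   Context: An instance of MP-KHD consists of: a bipartite graph $G=(I,J,E)$ with finite sets $I$ (offline agent types) and $J$ (online agent types); a finite set of prices $\{a_1,\dots,a_K\}$; a capacity $b_i\in\mathbb{Z}_{>0}$ for each $i\in I$; a horizon $T\in\mathbb{Z}_{>0}$; for each $t\in[T]$ a probability distribution $(q_{j,t})_{j\in J}$ on $J$; the assignment set $\mathcal{F}=\{(i,j,k):(i,j)\in E,k\in[K]\}$; for each $f\in\mathcal{F}$, $t\in[T]$, an acceptance probability $p_{f,t}\in(0,1]$ and profit $w_{f,t}\ge0$. $\mathcal{F}_j$ ($\mathcal{F}_i$) is the set of assignments with second (first) coordinate $j$ ($i$). The instance is known in advance. In each round $t$, an online agent type $\hat j_t$ arrives, independently across rounds, with $\Pr[\hat j_t=j]=q_{j,t}$; the policy irrevocably rejects it or selects one $f=(i,\hat j_t,k)\in\mathcal{F}_{\hat j_t}$ with $i$ having remaining capacity; the agent independently accepts with probability $p_{f,t}$ (then $i$'s capacity drops by one and profit $w_{f,t}$ is earned), else nothing happens. A successful assignment is one selected and accepted. An online policy decides in round $t$ using only information revealed up to round $t$. $\mathrm{OPT\text{-}OFF}$ is the maximum expected total profit of a clairvoyant policy that observes the whole arrival sequence before deciding. A policy has competitive ratio (at least) $\rho$ if its expected profit is at least $\rho\cdot\mathrm{OPT\text{-}OFF}$ on every instance. All expectations/variances are over arrivals, the policy's internal randomness, and acceptance outcomes. Policy $\mathsf{ATT}(\gamma)$, $\gamma\in[0,1/2]$: replace each offline type $i$ by $b_i$ copies of capacity 1 (each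 copy inheriting $i$'s edges, probabilities and profits), and work with this unit-capacity instance (so $|I|=B$). Solve the LP $\max\sum_{t,f}x_{f,t}p_{f,t}w_{f,t}$ s.t. $\sum_{f\in\mathcal{F}_j}x_{f,t}\le q_{j,t}$ for all $j,t$; $\sum_{t}\sum_{f\in\mathcal{F}_i}x_{f,t}p_{f,t}\le 1$ for all $i$; $x\ge0$; let $x$ be an optimal solution. Set $\beta_{i,t}=1-\gamma\sum_{t'<t}\sum_{f\in\mathcal{F}_i}x_{f,t'}p_{f,t'}$. In round $t$, when $j$ arrives, sample at most one assignment, choosing each $f=(i,j,k)\in\mathcal{F}_j$ with probability $\frac{x_{f,t}}{q_{j,t}}\cdot\frac{\gamma}{\beta_{i,t}}$ (these sum to at most 1); if some $f=(i,j,k)$ is sampled and $i$ still has its unit of capacity, select $f$ (match $j$ to $i$ at price $a_k$); otherwise reject. *)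

theory Defs
  imports "HOL-Probability.Probability"
begin

section \<open>Instances of MP-KHD\<close>

text \<open>
  Rounds \<open>[T]\<close> are numbered \<open>0, \<dots>, T - 1\<close> and price indices \<open>[K]\<close> are numbered
  \<open>0, \<dots>, K - 1\<close>. An assignment is a triple (offline type, online type, price index).
\<close>

type_synonym ('i, 'j) assignment = "'i \<times> 'j \<times> nat"

record ('i, 'j) mpkhd =
  offline     :: "'i set"
  online      :: "'j set"
  edges       :: "('i \<times> 'j) set"
  num_prices  :: nat
  price       :: "nat \<Rightarrow> real"
  capacity    :: "'i \<Rightarrow> nat"
  horizon     :: nat
  arrival     :: "nat \<Rightarrow> 'j pmf"
  accept_prob :: "('i, 'j) assignment \<Rightarrow> nat \<Rightarrow> real"
  profit      :: "('i, 'j) assignment \<Rightarrow> nat \<Rightarrow> real"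

definition assignments :: "('i, 'j) mpkhd \<Rightarrow> ('i, 'j) assignment set" where
  "assignments inst = {(i, j, k). (i, j) \<in> edges inst \<and> k < num_prices inst}"

definition assignments_online :: "('i, 'j) mpkhd \<Rightarrow> 'j \<Rightarrow> ('i, 'j) assignment set" where
  "assignments_online inst j = {f \<in> assignments inst. fst (snd f) = j}"

definition assignments_offline :: "('i, 'j) mpkhd \<Rightarrow> 'i \<Rightarrow> ('i, 'j) assignment set" where
  "assignments_offline inst i = {f \<in> assignments inst. fst f = i}"

definition valid_instance :: "('i, 'j) mpkhd \<Rightarrow> bool" where
  "valid_instance inst \<longleftrightarrow>
     finite (offline inst) \<and> finite (online inst) \<and>
     edges inst \<subseteq> offline inst \<times> online inst \<and>
     inj_on (price inst) {..<num_prices inst} \<and>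
     (\<forall>i\<in>offline inst. capacity inst i > 0) \<and>
     horizon inst > 0 \<and>
     (\<forall>t<horizon inst. set_pmf (arrival inst t) \<subseteq> online inst) \<and>
     (\<forall>f\<in>assignments inst. \<forall>t<horizon inst.
        0 < accept_prob inst f t \<and> accept_prob inst f t \<le> 1 \<and> 0 \<le> profit inst f t)"

definition total_capacity :: "('i, 'j) mpkhd \<Rightarrow> nat" where
  "total_capacity inst = (\<Sum>i\<in>offline inst. capacity inst i)"


section \<open>Policies and the stochastic process\<close>

text \<open>
  An event records one round: the arriving type, a private memo of the policy, the selected
  assignment (\<open>None\<close> means rejection) and whether a selected assignment was accepted.
  A policy maps the history of the preceding rounds and the current arrival to a distribution over
  memos and decisions. The memos are never seen by the environment; they allow the policy to
  remember the outcomes of its internal randomization (in particular, which copy of an offline type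
  it used), so that policies with correlated randomness or internal state are covered.
\<close>

datatype ('i, 'j) event =
  Event (arrived: 'j) (memo: nat) (selected: "('i, 'j) assignment option") (accepted: bool)

type_synonym ('i, 'j) history = "('i, 'j) event list"

type_synonym ('i, 'j) policy =
  "('i, 'j) history \<Rightarrow> 'j \<Rightarrow> (nat \<times> ('i, 'j) assignment option) pmf"

definition acceptance :: "('i, 'j) mpkhd \<Rightarrow> nat \<Rightarrow> ('i, 'j) assignment option \<Rightarrow> bool pmf" where
  "acceptance inst t s =
     (case s of None \<Rightarrow> return_pmf False | Some f \<Rightarrow> bernoulli_pmf (accept_prob inst f t))"

text \<open>The first \<open>n\<close> rounds of the process for a fixed arrival sequence \<open>\<sigma>\<close>.\<close>

primrec play :: "('i, 'j) mpkhd \<Rightarrow> (nat \<Rightarrow> 'j) \<Rightarrow> ('i, 'j) policy \<Rightarrow> nat \<Rightarrow> ('i, 'j) history pmf" where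
  "play inst \<sigma> \<pi> 0 = return_pmf []"
| "play inst \<sigma> \<pi> (Suc t) =
     bind_pmf (play inst \<sigma> \<pi> t) (\<lambda>h.
     bind_pmf (\<pi> h (\<sigma> t)) (\<lambda>(m, s).
     bind_pmf (acceptance inst t s) (\<lambda>a.
     return_pmf (h @ [Event (\<sigma> t) m s a]))))"

definition arrivals :: "('i, 'j) mpkhd \<Rightarrow> (nat \<Rightarrow> 'j) pmf" where
  "arrivals inst = Pi_pmf {..<horizon inst} undefined (arrival inst)"

definition used_capacity :: "('i, 'j) history \<Rightarrow> 'i \<Rightarrow> nat" where
  "used_capacity h i =
     length (filter (\<lambda>e. accepted e \<and> (\<exists>j k. selected e = Some (i, j, k))) h)"

definition feasible_on :: "('i, 'j) mpkhd \<Rightarrow> (nat \<Rightarrow> 'j) \<Rightarrow> ('i, 'j) policy \<Rightarrow> bool" where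
  "feasible_on inst \<sigma> \<pi> \<longleftrightarrow>
     (\<forall>t<horizon inst. \<forall>h\<in>set_pmf (play inst \<sigma> \<pi> t). \<forall>m f. (m, Some f) \<in> set_pmf (\<pi> h (\<sigma> t)) \<longrightarrow>
        f \<in> assignments_online inst (\<sigma> t) \<and> used_capacity h (fst f) < capacity inst (fst f))"

definition online_policy :: "('i, 'j) mpkhd \<Rightarrow> ('i, 'j) policy \<Rightarrow> bool" where
  "online_policy inst \<pi> \<longleftrightarrow> (\<forall>\<sigma>\<in>set_pmf (arrivals inst). feasible_on inst \<sigma> \<pi>)"

definition outcome :: "('i, 'j) mpkhd \<Rightarrow> ('i, 'j) policy \<Rightarrow> ('i, 'j) history pmf" where
  "outcome inst \<pi> = bind_pmf (arrivals inst) (\<lambda>\<sigma>. play inst \<sigma> \<pi> (horizon inst))"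

definition total_profit :: "('i, 'j) mpkhd \<Rightarrow> ('i, 'j) history \<Rightarrow> real" where
  "total_profit inst h =
     (\<Sum>t<length h. if accepted (h ! t) then profit inst (the (selected (h ! t))) t else 0)"

definition num_successes :: "('i, 'j) history \<Rightarrow> nat" where
  "num_successes h = length (filter accepted h)"

definition expected_profit :: "('i, 'j) mpkhd \<Rightarrow> ('i, 'j) policy \<Rightarrow> real" where
  "expected_profit inst \<pi> = measure_pmf.expectation (outcome inst \<pi>) (total_profit inst)"

definition variance_successes :: "('i, 'j) mpkhd \<Rightarrow> ('i, 'j) policy \<Rightarrow> real" where
  "variance_successes inst \<pi> =
     measure_pmf.variance (outcome inst \<pi>) (\<lambda>h. real (num_successes h))"


section \<open>The clairvoyant benchmark and competitive ratios\<close>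

text \<open>
  A clairvoyant policy chooses its behaviour \<open>\<phi> \<sigma>\<close> after seeing the whole arrival sequence
  \<open>\<sigma>\<close>; it learns acceptance outcomes only as they occur.
\<close>

definition clairvoyant_policy ::
  "('i, 'j) mpkhd \<Rightarrow> ((nat \<Rightarrow> 'j) \<Rightarrow> ('i, 'j) policy) \<Rightarrow> bool" where
  "clairvoyant_policy inst \<phi> \<longleftrightarrow> (\<forall>\<sigma>\<in>set_pmf (arrivals inst). feasible_on inst \<sigma> (\<phi> \<sigma>))"

definition clairvoyant_outcome ::
  "('i, 'j) mpkhd \<Rightarrow> ((nat \<Rightarrow> 'j) \<Rightarrow> ('i, 'j) policy) \<Rightarrow> ('i, 'j) history pmf" where
  "clairvoyant_outcome inst \<phi> =
     bind_pmf (arrivals inst) (\<lambda>\<sigma>. play inst \<sigma> (\<phi> \<sigma>) (horizon inst))"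

definition OPT_OFF :: "('i, 'j) mpkhd \<Rightarrow> real" where
  "OPT_OFF inst =
     (SUP \<phi>\<in>{\<phi>. clairvoyant_policy inst \<phi>}.
        measure_pmf.expectation (clairvoyant_outcome inst \<phi>) (total_profit inst))"

text \<open>
  As the instance is known in advance, a policy for the problem is a map from instances to
  online policies.
\<close>

definition competitive_ratio :: "(('i, 'j) mpkhd \<Rightarrow> ('i, 'j) policy) \<Rightarrow> real \<Rightarrow> bool" where
  "competitive_ratio A \<rho> \<longleftrightarrow>
     (\<forall>inst. valid_instance inst \<longrightarrow>
        online_policy inst (A inst) \<and> expected_profit inst (A inst) \<ge> \<rho> * OPT_OFF inst)"


section \<open>The attenuation policy\<close>

definition unit_instance :: "('i, 'j) mpkhd \<Rightarrow> ('i \<times> nat, 'j) mpkhd" where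
  "unit_instance inst =
     \<lparr>offline = (SIGMA i:offline inst. {..<capacity inst i}),
      online = online inst,
      edges = {((i, c), j). (i, j) \<in> edges inst \<and> c < capacity inst i},
      num_prices = num_prices inst,
      price = price inst,
      capacity = (\<lambda>_. 1),
      horizon = horizon inst,
      arrival = arrival inst,
      accept_prob = (\<lambda>((i, c), j, k). accept_prob inst (i, j, k)),
      profit = (\<lambda>((i, c), j, k). profit inst (i, j, k))\<rparr>"

text \<open>The linear program is only used for unit-capacity instances, hence the right-hand side 1.\<close>

definition lp_feasible :: "('i, 'j) mpkhd \<Rightarrow> (('i, 'j) assignment \<Rightarrow> nat \<Rightarrow> real) \<Rightarrow> bool" where
  "lp_feasible inst x \<longleftrightarrow>
     (\<forall>t<horizon inst. \<forall>j\<in>online inst.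
        (\<Sum>f\<in>assignments_online inst j. x f t) \<le> pmf (arrival inst t) j) \<and>
     (\<forall>i\<in>offline inst.
        (\<Sum>t<horizon inst. \<Sum>f\<in>assignments_offline inst i. x f t * accept_prob inst f t) \<le> 1) \<and>
     (\<forall>t<horizon inst. \<forall>f\<in>assignments inst. x f t \<ge> 0)"

definition lp_value :: "('i, 'j) mpkhd \<Rightarrow> (('i, 'j) assignment \<Rightarrow> nat \<Rightarrow> real) \<Rightarrow> real" where
  "lp_value inst x =
     (\<Sum>t<horizon inst. \<Sum>f\<in>assignments inst. x f t * accept_prob inst f t * profit inst f t)"

definition lp_optimal :: "('i, 'j) mpkhd \<Rightarrow> (('i, 'j) assignment \<Rightarrow> nat \<Rightarrow> real) \<Rightarrow> bool" where
  "lp_optimal inst x \<longleftrightarrow>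
     lp_feasible inst x \<and> (\<forall>y. lp_feasible inst y \<longrightarrow> lp_value inst y \<le> lp_value inst x)"

definition att_beta ::
  "('i, 'j) mpkhd \<Rightarrow> real \<Rightarrow> (('i, 'j) assignment \<Rightarrow> nat \<Rightarrow> real) \<Rightarrow> 'i \<Rightarrow> nat \<Rightarrow> real" where
  "att_beta inst \<gamma> x i t =
     1 - \<gamma> * (\<Sum>t'<t. \<Sum>f\<in>assignments_offline inst i. x f t' * accept_prob inst f t')"

definition att_prob ::
  "('i, 'j) mpkhd \<Rightarrow> real \<Rightarrow> (('i, 'j) assignment \<Rightarrow> nat \<Rightarrow> real) \<Rightarrow> nat \<Rightarrow> ('i, 'j) assignment \<Rightarrow> real" where
  "att_prob inst \<gamma> x t f =
     x f t / pmf (arrival inst t) (fst (snd f)) * (\<gamma> / att_beta inst \<gamma> x (fst f) t)"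

definition att_sample ::
  "('i, 'j) mpkhd \<Rightarrow> real \<Rightarrow> (('i, 'j) assignment \<Rightarrow> nat \<Rightarrow> real) \<Rightarrow> nat \<Rightarrow> 'j
     \<Rightarrow> ('i, 'j) assignment option pmf" where
  "att_sample inst \<gamma> x t j = embed_pmf (\<lambda>s. case s of
       None \<Rightarrow> 1 - (\<Sum>f\<in>assignments_online inst j. att_prob inst \<gamma> x t f)
     | Some f \<Rightarrow> if f \<in> assignments_online inst j then att_prob inst \<gamma> x t f else 0)"

definition copy_used :: "('i, 'j) history \<Rightarrow> 'i \<Rightarrow> nat \<Rightarrow> bool" where
  "copy_used h i c \<longleftrightarrow>
     (\<exists>e\<in>set h. accepted e \<and> memo e = c \<and> (\<exists>j k. selected e = Some (i, j, k)))"

text \<open>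
  \<open>x\<close> is a solution of the linear program of the unit-capacity instance. The policy acts on the
  original instance: matching to copy \<open>c\<close> of \<open>i\<close> means matching to \<open>i\<close> and recording \<open>c\<close>
  as the memo.
\<close>

definition ATT ::
  "('i, 'j) mpkhd \<Rightarrow> real \<Rightarrow> (('i \<times> nat, 'j) assignment \<Rightarrow> nat \<Rightarrow> real) \<Rightarrow> ('i, 'j) policy" where
  "ATT inst \<gamma> x h j =
     map_pmf (\<lambda>s. case s of
         None \<Rightarrow> (0, None)
       | Some ((i, c), j', k) \<Rightarrow> if copy_used h i c then (0, None) else (c, Some (i, j', k)))
       (att_sample (unit_instance inst) \<gamma> x (length h) j)"

end

theory Submission
  imports Defs
begin

text \<open>
  Condition on the arrival sequence. Averaging the selection probabilities of a clairvoyant policy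
  gives a feasible LP solution of the same value, so the LP bounds \<open>OPT_OFF\<close>. For the attenuation
  policy, the rounds affect a set \<open>S\<close> of copies independently: given the arrivals, \<open>S\<close> stays entirely
  unused with a probability that is a product over the rounds, and averaging over the independent
  arrivals gives the product of the factors \<open>1 - (\<Sum>u\<in>S. rate u t)\<close>. For a single copy this telescopes
  to \<open>\<beta>\<close>, which cancels the attenuation and yields exactly \<open>\<gamma>\<close> times the LP value; for two copies
  it is at most the product of the single probabilities, so the indicators of the copies are
  negatively correlated and the variance is at most the sum of Bernoulli variances.
\<close>

section \<open>Expectations and the stochastic process\<close>

text \<open>Once the arrival sequence is fixed, a clairvoyant policy is an ordinary policy, and an
  online policy is a clairvoyant one that ignores the sequence. The same lemmas therefore serve the
  benchmark and the algorithm. The availability of a copy depends on the history, but the sampling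
  law does not. While a set of copies is untouched, the availability check never blocks a sample
  from it, so survival is decided round by round. The bound \<gamma> \<le> 1/2 enters twice: it
  makes the sampling weights sum to at most 1, and it puts the survival probability \<beta> \<ge> 1
  - \<gamma> on the decreasing branch of b(1 - b), so that a Bernoulli variance is at most
  \<gamma>(1 - \<gamma>). Tightness comes from an instance in which every round concerns its own
  copy with certainty. The barrier 1/2 comes from two rounds in which clairvoyance is worth almost 2
  while every online policy earns at most 1.\<close>

text \<open>Memos range over \<open>nat\<close>, so a play may have infinite support and
  integrability has to come from a bound. The bound is asked for on the support alone, since
  \<open>total_profit\<close> is unbounded over arbitrary histories; cutting \<open>f\<close> to 0
  elsewhere makes it globally bounded.\<close>

lemma expectation_bind_pmf:
  fixes f :: "'b \<Rightarrow> real"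
  assumes bound: "\<And>y. y \<in> set_pmf (bind_pmf M N) \<Longrightarrow> \<bar>f y\<bar> \<le> C"
  shows "measure_pmf.expectation (bind_pmf M N) f =
         measure_pmf.expectation M (\<lambda>x. measure_pmf.expectation (N x) f)"
proof -
  define g where "g y = (if y \<in> set_pmf (bind_pmf M N) then f y else 0)" for y
  have gb: "\<bar>g y\<bar> \<le> max C 0" for y
    using bound[of y] by (cases "y \<in> set_pmf (bind_pmf M N)") (simp_all add: g_def del: set_bind_pmf)
  have "measure_pmf.expectation (bind_pmf M N) f = measure_pmf.expectation (bind_pmf M N) g"
    by (intro integral_cong_AE) (auto simp: AE_measure_pmf_iff g_def)
  also have "\<dots> = measure_pmf.expectation M (\<lambda>x. measure_pmf.expectation (N x) g)"
    unfolding measure_pmf_bind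
    by (rule integral_bind[where K = "count_space UNIV" and B = "max C 0" and B' = 1])
       (use gb measurable_measure_pmf[of N] in \<open>auto intro: measure_pmf.finite_measure_axioms
          simp: measure_pmf.emeasure_space_1 space_subprob_algebra\<close>)
  also have "\<dots> = measure_pmf.expectation M (\<lambda>x. measure_pmf.expectation (N x) f)"
    by (intro integral_cong_AE) (auto simp: AE_measure_pmf_iff g_def
        intro!: integral_cong_AE)
  finally show ?thesis .
qed

lemma prob_bind_pmf:
  "measure_pmf.prob (bind_pmf M N) A = measure_pmf.expectation M (\<lambda>x. measure_pmf.prob (N x) A)"
  using expectation_bind_pmf[of M N "indicator A" 1] by (simp add: indicator_def)

lemma integrable_bounded_pmf:
  fixes f :: "'a \<Rightarrow> real"
  assumes "\<And>x. x \<in> set_pmf M \<Longrightarrow> \<bar>f x\<bar> \<le> C"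
  shows "integrable (measure_pmf M) f"
  by (rule measure_pmf.integrable_const_bound[where B = C]) (use assms in \<open>auto simp: AE_measure_pmf_iff\<close>)

lemma expectation_pmf_cong:
  fixes f g :: "'a \<Rightarrow> real"
  assumes "\<And>x. x \<in> set_pmf M \<Longrightarrow> f x = g x"
  shows "measure_pmf.expectation M f = measure_pmf.expectation M g"
  by (intro integral_cong_AE) (use assms in \<open>auto simp: AE_measure_pmf_iff\<close>)

lemma expectation_pmf_mono:
  fixes f g :: "'a \<Rightarrow> real"
  assumes "integrable (measure_pmf M) f" "integrable (measure_pmf M) g"
    and "\<And>x. x \<in> set_pmf M \<Longrightarrow> f x \<le> g x"
  shows "measure_pmf.expectation M f \<le> measure_pmf.expectation M g"
  by (intro integral_mono_AE) (use assms in \<open>auto simp: AE_measure_pmf_iff\<close>)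

section \<open>Marginal selection probabilities and additive rewards\<close>

text \<open>Law of the selection in round \<open>t\<close>, averaged over histories and memos.
  Expected profit and expected capacity usage depend on a policy through these marginals
  alone.\<close>

definition decision ::
  "('i, 'j) mpkhd \<Rightarrow> (nat \<Rightarrow> 'j) \<Rightarrow> ('i, 'j) policy \<Rightarrow> nat \<Rightarrow> ('i, 'j) assignment option pmf" where
  "decision inst \<sigma> \<pi> t = bind_pmf (play inst \<sigma> \<pi> t) (\<lambda>h. map_pmf snd (\<pi> h (\<sigma> t)))"

lemma set_play_Suc:
  "h \<in> set_pmf (play inst \<sigma> \<pi> (Suc t)) \<longleftrightarrow>
     (\<exists>h' m s a. h' \<in> set_pmf (play inst \<sigma> \<pi> t) \<and> (m, s) \<in> set_pmf (\<pi> h' (\<sigma> t)) \<and>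
        a \<in> set_pmf (acceptance inst t s) \<and> h = h' @ [Event (\<sigma> t) m s a])"
  by (fastforce split: prod.splits)

lemma length_play: "h \<in> set_pmf (play inst \<sigma> \<pi> n) \<Longrightarrow> length h = n"
  by (induction n arbitrary: h) (auto simp: set_play_Suc simp del: play.simps(2))

lemma map_take_play_Suc: "map_pmf (take t) (play inst \<sigma> \<pi> (Suc t)) = play inst \<sigma> \<pi> t"
proof -
  have "map_pmf (take t) (play inst \<sigma> \<pi> (Suc t)) =
        bind_pmf (play inst \<sigma> \<pi> t) (\<lambda>h. bind_pmf (\<pi> h (\<sigma> t))
          (\<lambda>(m, s). bind_pmf (acceptance inst t s) (\<lambda>a. return_pmf (take t h))))"
    by (auto simp: map_bind_pmf length_play intro!: bind_pmf_cong split: prod.splits)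
  also have "\<dots> = bind_pmf (play inst \<sigma> \<pi> t) return_pmf"
    by (intro bind_pmf_cong refl) (simp add: length_play case_prod_unfold)
  finally show ?thesis by (simp add: bind_return_pmf')
qed

lemma map_take_play: "t \<le> n \<Longrightarrow> map_pmf (take t) (play inst \<sigma> \<pi> n) = play inst \<sigma> \<pi> t"
proof (induction n rule: dec_induct)
  case base
  have "map_pmf (take t) (play inst \<sigma> \<pi> t) = map_pmf (\<lambda>h. h) (play inst \<sigma> \<pi> t)"
    by (intro map_pmf_cong) (auto simp: length_play)
  then show ?case by simp
next
  case (step n)
  have "map_pmf (take t) (play inst \<sigma> \<pi> (Suc n)) =
        map_pmf (take t) (map_pmf (take n) (play inst \<sigma> \<pi> (Suc n)))"
    using step by (simp add: pmf.map_comp o_def min_def del: play.simps(2))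
  with step show ?case by (simp only: map_take_play_Suc)
qed

text \<open>Later rounds only append to the history, so the law of round \<open>t\<close> can be
  read off from the play of \<open>Suc t\<close> rounds.\<close>

lemma map_event_play:
  assumes "t < n"
  shows "map_pmf (\<lambda>h. (selected (h ! t), accepted (h ! t))) (play inst \<sigma> \<pi> n) =
         bind_pmf (decision inst \<sigma> \<pi> t) (\<lambda>s. map_pmf (Pair s) (acceptance inst t s))"
proof -
  have "map_pmf (\<lambda>h. (selected (h ! t), accepted (h ! t))) (play inst \<sigma> \<pi> n) =
        map_pmf (\<lambda>h. (selected (h ! t), accepted (h ! t))) (map_pmf (take (Suc t)) (play inst \<sigma> \<pi> n))"
    using assms by (simp add: pmf.map_comp o_def)
  also have "map_pmf (take (Suc t)) (play inst \<sigma> \<pi> n) = play inst \<sigma> \<pi> (Suc t)"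
    using assms by (intro map_take_play) simp
  also have "map_pmf (\<lambda>h. (selected (h ! t), accepted (h ! t))) \<dots> =
     bind_pmf (play inst \<sigma> \<pi> t) (\<lambda>h. bind_pmf (\<pi> h (\<sigma> t))
       (\<lambda>x. bind_pmf (acceptance inst t (snd x)) (\<lambda>a. return_pmf (snd x, a))))"
    unfolding play.simps map_bind_pmf
    by (intro bind_pmf_cong refl)
       (auto simp: map_bind_pmf length_play nth_append split: prod.splits intro!: bind_pmf_cong)
  finally show ?thesis
    by (simp add: decision_def bind_assoc_pmf bind_map_pmf map_pmf_def[of "Pair _"])
qed

text \<open>Given the selection, the acceptance coin is independent of the history, hence the
  product.\<close>

lemma prob_success:
  assumes "t < n" "0 \<le> accept_prob inst f t" "accept_prob inst f t \<le> 1"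
  shows "measure_pmf.prob (play inst \<sigma> \<pi> n) {h. selected (h ! t) = Some f \<and> accepted (h ! t)} =
         pmf (decision inst \<sigma> \<pi> t) (Some f) * accept_prob inst f t"
proof -
  let ?D = "decision inst \<sigma> \<pi> t"
  have "measure_pmf.prob (play inst \<sigma> \<pi> n) {h. selected (h ! t) = Some f \<and> accepted (h ! t)} =
        pmf (map_pmf (\<lambda>h. (selected (h ! t), accepted (h ! t))) (play inst \<sigma> \<pi> n)) (Some f, True)"
    by (simp add: pmf_map vimage_def)
  also have "\<dots> = measure_pmf.expectation ?D
      (\<lambda>s. pmf (map_pmf (Pair s) (acceptance inst t s)) (Some f, True))"
    by (simp add: map_event_play[OF assms(1)] pmf_bind)
  also have "\<dots> = measure_pmf.expectation ?D (\<lambda>s. indicator {Some f} s * accept_prob inst f t)"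
  proof (rule expectation_pmf_cong)
    fix s
    show "pmf (map_pmf (Pair s) (acceptance inst t s)) (Some f, True) =
          indicator {Some f} s * accept_prob inst f t"
    proof (cases "s = Some f")
      case True
      have "pmf (map_pmf (Pair s) (acceptance inst t s)) (s, True) = pmf (acceptance inst t s) True"
        by (rule pmf_map_inj') (simp add: inj_def)
      with True assms show ?thesis by (simp add: acceptance_def)
    qed (auto intro!: pmf_map_outside)
  qed
  finally show ?thesis by (simp add: pmf.rep_eq)
qed

text \<open>\<open>feasible_on\<close> restricts single decisions at reachable histories; induction
  over the rounds turns this into invariants of whole histories.\<close>

lemma feasible_play:
  assumes "feasible_on inst \<sigma> \<pi>" "n \<le> horizon inst" "h \<in> set_pmf (play inst \<sigma> \<pi> n)"
  shows "used_capacity h i \<le> capacity inst i"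
    and "t < n \<Longrightarrow> selected (h ! t) = Some f \<Longrightarrow> f \<in> assignments_online inst (\<sigma> t)"
    and "t < n \<Longrightarrow> accepted (h ! t) \<Longrightarrow> selected (h ! t) \<noteq> None"
proof -
  have "used_capacity h i \<le> capacity inst i \<and>
    (\<forall>t<n. (\<forall>f. selected (h ! t) = Some f \<longrightarrow> f \<in> assignments_online inst (\<sigma> t)) \<and>
       (accepted (h ! t) \<longrightarrow> selected (h ! t) \<noteq> None))"
    using assms(2,3)
  proof (induction n arbitrary: h)
    case 0
    then show ?case by (simp add: used_capacity_def)
  next
    case (Suc n)
    from Suc.prems(2) obtain h' m s a where h': "h' \<in> set_pmf (play inst \<sigma> \<pi> n)"
      "(m, s) \<in> set_pmf (\<pi> h' (\<sigma> n))" "a \<in> set_pmf (acceptance inst n s)"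
      and h: "h = h' @ [Event (\<sigma> n) m s a]"
      unfolding set_play_Suc by blast
    have IH: "used_capacity h' i \<le> capacity inst i"
      "\<And>t f. t < n \<Longrightarrow> selected (h' ! t) = Some f \<Longrightarrow> f \<in> assignments_online inst (\<sigma> t)"
      "\<And>t. t < n \<Longrightarrow> accepted (h' ! t) \<Longrightarrow> selected (h' ! t) \<noteq> None"
      using Suc.IH[OF _ h'(1)] Suc.prems(1) by auto
    have len: "length h' = n" using h'(1) by (rule length_play)
    have new: "f \<in> assignments_online inst (\<sigma> n) \<and> used_capacity h' (fst f) < capacity inst (fst f)"
      if "s = Some f" for f
      using assms(1) h' that Suc.prems(1) unfolding feasible_on_def by (meson Suc_le_eq)
    have acc: "a \<Longrightarrow> s \<noteq> None"
      using h'(3) by (cases s) (auto simp: acceptance_def)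
    have "used_capacity h i \<le> capacity inst i"
      using IH(1) new by (auto simp: h used_capacity_def)
    moreover have "(\<forall>f. selected (h ! t) = Some f \<longrightarrow> f \<in> assignments_online inst (\<sigma> t)) \<and>
       (accepted (h ! t) \<longrightarrow> selected (h ! t) \<noteq> None)" if "t < Suc n" for t
      using IH(2,3) new acc len that by (cases "t = n") (auto simp: h nth_append)
    ultimately show ?case by blast
  qed
  then show "used_capacity h i \<le> capacity inst i"
    and "t < n \<Longrightarrow> selected (h ! t) = Some f \<Longrightarrow> f \<in> assignments_online inst (\<sigma> t)"
    and "t < n \<Longrightarrow> accepted (h ! t) \<Longrightarrow> selected (h ! t) \<noteq> None"
    by blast+
qed

lemma set_decision:
  assumes "feasible_on inst \<sigma> \<pi>" "t < horizon inst" "Some f \<in> set_pmf (decision inst \<sigma> \<pi> t)"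
  shows "f \<in> assignments_online inst (\<sigma> t)"
  proof -
  from assms(3) obtain h m where "h \<in> set_pmf (play inst \<sigma> \<pi> t)" "(m, Some f) \<in> set_pmf (\<pi> h (\<sigma> t))"
    by (auto simp: decision_def)
  then show ?thesis using assms(1,2) unfolding feasible_on_def by blast
qed

lemma finite_assignments: "valid_instance inst \<Longrightarrow> finite (assignments inst)"
proof -
  assume "valid_instance inst"
  then have "finite (edges inst)"
    unfolding valid_instance_def by (meson finite_SigmaI finite_subset)
  moreover have "assignments inst \<subseteq> (\<lambda>((i, j), k). (i, j, k)) ` (edges inst \<times> {..<num_prices inst})"
    by (force simp: assignments_def)
  ultimately show ?thesis by (meson finite_SigmaI finite_imageI finite_lessThan finite_subset)
qed

text \<open>Linearity of expectation, proved once for arbitrary weights \<open>v\<close>: profits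
  give the total profit, the indicator of an offline type gives its capacity usage. The second part
  supplies the bound that \<open>expectation_bind_pmf\<close> asks for.\<close>

lemma expectation_additive:
  fixes inst :: "('i, 'j) mpkhd" and v :: "nat \<Rightarrow> ('i, 'j) assignment \<Rightarrow> real"
  assumes valid: "valid_instance inst" and feas: "feasible_on inst \<sigma> \<pi>"
  defines "F \<equiv> \<lambda>h. \<Sum>t<length h. if accepted (h ! t) then v t (the (selected (h ! t))) else 0"
  shows "measure_pmf.expectation (play inst \<sigma> \<pi> (horizon inst)) F =
      (\<Sum>t<horizon inst. \<Sum>f\<in>assignments inst.
         pmf (decision inst \<sigma> \<pi> t) (Some f) * accept_prob inst f t * v t f)"
    and "\<And>h. h \<in> set_pmf (play inst \<sigma> \<pi> (horizon inst)) \<Longrightarrow>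
           \<bar>F h\<bar> \<le> (\<Sum>t<horizon inst. \<Sum>f\<in>assignments inst. \<bar>v t f\<bar>)"
proof -
  let ?T = "horizon inst" and ?P = "play inst \<sigma> \<pi> (horizon inst)"
  let ?A = "\<lambda>t f. {h :: ('i, 'j) history. selected (h ! t) = Some f \<and> accepted (h ! t)}"
  have fin: "finite (assignments inst)" using valid by (rule finite_assignments)
  \<comment> \<open>An accepted round has exactly one selected assignment, so exactly one term of
    its inner sum survives.\<close>
  have F: "F h = (\<Sum>t<?T. \<Sum>f\<in>assignments inst. v t f * indicator (?A t f) h)"
    if h: "h \<in> set_pmf ?P" for h
  proof -
    have "(if accepted (h ! t) then v t (the (selected (h ! t))) else 0) =
          (\<Sum>f\<in>assignments inst. v t f * indicator (?A t f) h)" if t: "t < ?T" for t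
    proof (cases "accepted (h ! t)")
      case True
      then obtain g where g: "selected (h ! t) = Some g"
        using feasible_play(3)[OF feas order_refl h t] by auto
      then have "g \<in> assignments inst"
        using feasible_play(2)[OF feas order_refl h t] by (auto simp: assignments_online_def)
      moreover have "(\<Sum>f\<in>assignments inst. v t f * indicator (?A t f) h) =
            (\<Sum>f\<in>assignments inst. if g = f then v t f else 0)"
        using True g by (intro sum.cong) (auto simp: indicator_def)
      ultimately show ?thesis using True g fin by simp
    qed (simp add: indicator_def)
    then show ?thesis
      using h by (simp add: F_def length_play)
  qed
  show "\<bar>F h\<bar> \<le> (\<Sum>t<?T. \<Sum>f\<in>assignments inst. \<bar>v t f\<bar>)" if "h \<in> set_pmf ?P" for h
    unfolding F[OF that]
    by (intro order_trans[OF sum_abs] sum_mono) (auto simp: indicator_def)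
  have int: "integrable (measure_pmf ?P) (\<lambda>h. v t f * indicator (?A t f) h)" for t f
    by (rule integrable_bounded_pmf[where C = "\<bar>v t f\<bar>"]) (simp add: indicator_def)
  have "measure_pmf.expectation ?P F =
        measure_pmf.expectation ?P (\<lambda>h. \<Sum>t<?T. \<Sum>f\<in>assignments inst. v t f * indicator (?A t f) h)"
    by (intro expectation_pmf_cong F)
  also have "\<dots> = (\<Sum>t<?T. \<Sum>f\<in>assignments inst. v t f * measure_pmf.prob ?P (?A t f))"
    by (simp only: Bochner_Integration.integral_sum[OF int]
        Bochner_Integration.integral_sum[OF Bochner_Integration.integrable_sum[OF int]]) simp
  also have "\<dots> = (\<Sum>t<?T. \<Sum>f\<in>assignments inst.
         pmf (decision inst \<sigma> \<pi> t) (Some f) * accept_prob inst f t * v t f)"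
  proof (intro sum.cong refl)
    fix t f assume "t \<in> {..<?T}" "f \<in> assignments inst"
    then show "v t f * measure_pmf.prob ?P (?A t f) =
        pmf (decision inst \<sigma> \<pi> t) (Some f) * accept_prob inst f t * v t f"
      using valid by (subst prob_success) (auto simp: valid_instance_def less_imp_le)
  qed
  finally show "measure_pmf.expectation ?P F = \<dots>" .
qed

text \<open>Brings usage into the shape of \<open>expectation_additive\<close>; the premise keeps
  \<open>the\<close> away from \<open>None\<close>.\<close>

lemma used_capacity_sum:
  assumes "\<And>t. t < length h \<Longrightarrow> accepted (h ! t) \<Longrightarrow> selected (h ! t) \<noteq> None"
  shows "real (used_capacity h i) =
    (\<Sum>t<length h. if accepted (h ! t) then of_bool (fst (the (selected (h ! t))) = i) else 0)"
proof -
  have "real (used_capacity h i) =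
     real (card {t. t < length h \<and> accepted (h ! t) \<and> (\<exists>j k. selected (h ! t) = Some (i, j, k))})"
    by (simp add: used_capacity_def length_filter_conv_card)
  also have "\<dots> = (\<Sum>t<length h. of_bool (accepted (h ! t) \<and> (\<exists>j k. selected (h ! t) = Some (i, j, k))))"
    by (simp add: sum.If_cases of_bool_def Int_def)
  also have "\<dots> = (\<Sum>t<length h. if accepted (h ! t) then of_bool (fst (the (selected (h ! t))) = i) else 0)"
    using assms by (intro sum.cong refl) fastforce
  finally show ?thesis .
qed


section \<open>The linear programming relaxation\<close>

lemma sum_assignments_online:
  assumes "valid_instance inst"
  shows "sum g (assignments_online inst j) =
    (\<Sum>f\<in>assignments inst. if fst (snd f) = j then g f else (0::real))"
  unfolding assignments_online_def using finite_assignments[OF assms]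
  by (simp add: sum.inter_filter)

lemma sum_assignments_offline:
  assumes "valid_instance inst"
  shows "sum g (assignments_offline inst i) =
    (\<Sum>f\<in>assignments inst. if fst f = i then g f else (0::real))"
  unfolding assignments_offline_def using finite_assignments[OF assms]
  by (simp add: sum.inter_filter)

section \<open>Unit copies and the comparison of clairvoyant policies with the LP\<close>

lemma unit_instance_sel [simp]:
  "offline (unit_instance inst) = (SIGMA i:offline inst. {..<capacity inst i})"
  "online (unit_instance inst) = online inst"
  "edges (unit_instance inst) = {((i, c), j). (i, j) \<in> edges inst \<and> c < capacity inst i}"
  "num_prices (unit_instance inst) = num_prices inst"
  "price (unit_instance inst) = price inst"
  "capacity (unit_instance inst) = (\<lambda>_. 1)"
  "horizon (unit_instance inst) = horizon inst"
  "arrival (unit_instance inst) = arrival inst"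
  "accept_prob (unit_instance inst) u = accept_prob inst (fst (fst u), snd u)"
  "profit (unit_instance inst) u = profit inst (fst (fst u), snd u)"
  by (auto simp: unit_instance_def case_prod_unfold)

lemma assignments_unit_instance:
  "assignments (unit_instance inst) =
     (\<lambda>(f, c). ((fst f, c), snd f)) ` (SIGMA f:assignments inst. {..<capacity inst (fst f)})"
  by (force simp: assignments_def)

lemma valid_unit_instance: "valid_instance inst \<Longrightarrow> valid_instance (unit_instance inst)"
  by (auto simp: valid_instance_def assignments_unit_instance)

lemma sum_unit_instance:
  assumes "valid_instance inst"
  shows "sum g (assignments (unit_instance inst)) =
    (\<Sum>f\<in>assignments inst. \<Sum>c<capacity inst (fst f). g ((fst f, c), snd f))"
proof -
  have "inj_on (\<lambda>(f, c). ((fst f, c), snd f)) (SIGMA f:assignments inst. {..<capacity inst (fst f)})"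
    by (auto simp: inj_on_def)
  then have "sum g (assignments (unit_instance inst)) =
     (\<Sum>(f, c)\<in>(SIGMA f:assignments inst. {..<capacity inst (fst f)}). g ((fst f, c), snd f))"
    unfolding assignments_unit_instance by (subst sum.reindex) (auto simp: case_prod_unfold)
  then show ?thesis
    using finite_assignments[OF assms] by (simp add: sum.Sigma)
qed

lemma finite_set_arrivals:
  assumes "valid_instance inst"
  shows "finite (set_pmf (arrivals inst))"
proof -
  have "finite (PiE_dflt {..<horizon inst} undefined (set_pmf \<circ> arrival inst))"
    using assms by (intro finite_PiE_dflt) (auto simp: valid_instance_def intro: finite_subset[of _ "online inst"])
  then show ?thesis by (simp add: arrivals_def set_Pi_pmf)
qed

lemma set_arrivals:
  assumes "\<sigma> \<in> set_pmf (arrivals inst)" "t < horizon inst"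
  shows "\<sigma> t \<in> set_pmf (arrival inst t)"
  using assms by (auto simp: arrivals_def set_Pi_pmf PiE_dflt_def)

lemma arrival_online:
  assumes "valid_instance inst" "\<sigma> \<in> set_pmf (arrivals inst)" "t < horizon inst"
  shows "\<sigma> t \<in> online inst"
  using set_arrivals[OF assms(2,3)] assms(1,3) by (auto simp: valid_instance_def)

lemma map_arrivals: "t < horizon inst \<Longrightarrow> map_pmf (\<lambda>\<sigma>. \<sigma> t) (arrivals inst) = arrival inst t"
  by (simp add: arrivals_def Pi_pmf_component)

lemma outcome_eq_clairvoyant: "outcome inst \<pi> = clairvoyant_outcome inst (\<lambda>_. \<pi>)"
  by (simp add: outcome_def clairvoyant_outcome_def)

lemma online_policy_eq_clairvoyant: "online_policy inst \<pi> \<longleftrightarrow> clairvoyant_policy inst (\<lambda>_. \<pi>)"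
  by (simp add: online_policy_def clairvoyant_policy_def)

lemma expectation_profit_clairvoyant:
  assumes valid: "valid_instance inst" and clair: "clairvoyant_policy inst \<phi>"
  shows "measure_pmf.expectation (clairvoyant_outcome inst \<phi>) (total_profit inst) =
    measure_pmf.expectation (arrivals inst) (\<lambda>\<sigma>. \<Sum>t<horizon inst. \<Sum>f\<in>assignments inst.
      pmf (decision inst \<sigma> (\<phi> \<sigma>) t) (Some f) * accept_prob inst f t * profit inst f t)"
proof -
  have feas: "feasible_on inst \<sigma> (\<phi> \<sigma>)" if "\<sigma> \<in> set_pmf (arrivals inst)" for \<sigma>
    using clair that by (simp add: clairvoyant_policy_def)
  note add = expectation_additive[OF valid feas, where v = "\<lambda>t f. profit inst f t", folded total_profit_def]
  have "measure_pmf.expectation (clairvoyant_outcome inst \<phi>) (total_profit inst) =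
    measure_pmf.expectation (arrivals inst)
      (\<lambda>\<sigma>. measure_pmf.expectation (play inst \<sigma> (\<phi> \<sigma>) (horizon inst)) (total_profit inst))"
    unfolding clairvoyant_outcome_def
    by (rule expectation_bind_pmf[where C = "\<Sum>t<horizon inst. \<Sum>f\<in>assignments inst. \<bar>profit inst f t\<bar>"])
       (auto intro: add(2))
  also have "\<dots> = measure_pmf.expectation (arrivals inst) (\<lambda>\<sigma>. \<Sum>t<horizon inst. \<Sum>f\<in>assignments inst.
      pmf (decision inst \<sigma> (\<phi> \<sigma>) t) (Some f) * accept_prob inst f t * profit inst f t)"
    by (intro expectation_pmf_cong add(1))
  finally show ?thesis .
qed

text \<open>Usage respects the capacity on every history, hence also in expectation. This is the
  offline LP constraint before averaging over arrivals and splitting into copies.\<close>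

lemma expected_usage_le:
  assumes valid: "valid_instance inst" and feas: "feasible_on inst \<sigma> \<pi>"
  shows "(\<Sum>t<horizon inst. \<Sum>f\<in>assignments inst.
      pmf (decision inst \<sigma> \<pi> t) (Some f) * accept_prob inst f t * of_bool (fst f = i)) \<le> capacity inst i"
proof -
  let ?P = "play inst \<sigma> \<pi> (horizon inst)"
  have "measure_pmf.expectation ?P (\<lambda>h. real (used_capacity h i)) =
    (\<Sum>t<horizon inst. \<Sum>f\<in>assignments inst.
      pmf (decision inst \<sigma> \<pi> t) (Some f) * accept_prob inst f t * of_bool (fst f = i))"
    unfolding expectation_additive(1)[OF valid feas, where v = "\<lambda>t f. of_bool (fst f = i)", symmetric]
    by (intro expectation_pmf_cong used_capacity_sum)
       (auto simp: length_play dest: feasible_play(3)[OF feas order_refl])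
  moreover have "measure_pmf.expectation ?P (\<lambda>h. real (used_capacity h i)) \<le>
      measure_pmf.expectation ?P (\<lambda>h. real (capacity inst i))"
    using feasible_play(1)[OF feas order_refl]
    by (intro expectation_pmf_mono integrable_bounded_pmf[where C = "real (capacity inst i)"]) auto
  ultimately show ?thesis by simp
qed

text \<open>The LP solution splits the average selection probabilities evenly among the copies.\<close>

lemma clairvoyant_lp:
  assumes valid: "valid_instance inst" and clair: "clairvoyant_policy inst \<phi>"
  obtains y where "lp_feasible (unit_instance inst) y"
    and "lp_value (unit_instance inst) y =
           measure_pmf.expectation (clairvoyant_outcome inst \<phi>) (total_profit inst)"
proof -
  let ?U = "unit_instance inst" and ?T = "horizon inst" and ?F = "assignments inst"
  let ?E = "measure_pmf.expectation (arrivals inst)"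
  define d where "d \<sigma> t f = pmf (decision inst \<sigma> (\<phi> \<sigma>) t) (Some f)" for \<sigma> t f
  define y where "y u t = ?E (\<lambda>\<sigma>. d \<sigma> t (fst (fst u), snd u)) / capacity inst (fst (fst u))"
    for u :: "('a \<times> nat, 'b) assignment" and t
  have int: "integrable (measure_pmf (arrivals inst)) g" for g :: "_ \<Rightarrow> real"
    by (intro integrable_measure_pmf_finite finite_set_arrivals valid)
  have feas: "feasible_on inst \<sigma> (\<phi> \<sigma>)" if "\<sigma> \<in> set_pmf (arrivals inst)" for \<sigma>
    using clair that by (simp add: clairvoyant_policy_def)
  have cap: "capacity inst (fst f) > 0" if "f \<in> ?F" for f
    using valid that by (auto simp: valid_instance_def assignments_def)
  have sum_y: "(\<Sum>u\<in>assignments ?U. y u t * g (fst (fst u), snd u)) = (\<Sum>f\<in>?F. ?E (\<lambda>\<sigma>. d \<sigma> t f) * g f)"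
    for g :: "_ \<Rightarrow> real" and t
    unfolding sum_unit_instance[OF valid] by (intro sum.cong refl) (use cap in \<open>auto simp: y_def\<close>)
  have "lp_feasible ?U y"
    unfolding lp_feasible_def
  proof (intro conjI allI impI ballI)
    fix t j assume t: "t < horizon ?U" and j: "j \<in> online ?U"
    have "sum (\<lambda>u. y u t) (assignments_online ?U j) =
        (\<Sum>u\<in>assignments ?U. y u t * of_bool (fst (snd (fst (fst u), snd u)) = j))"
      unfolding sum_assignments_online[OF valid_unit_instance[OF valid]] by (intro sum.cong) auto
    also have "\<dots> = ?E (\<lambda>\<sigma>. \<Sum>f\<in>?F. d \<sigma> t f * of_bool (fst (snd f) = j))"
      using sum_y[of t "\<lambda>f. of_bool (fst (snd f) = j)"] by (simp add: int)
    \<comment> \<open>Even with full foresight, only assignments of the type arriving in round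
      \<open>t\<close> can be selected, and at most one of them. Averaging this pathwise bound
      leaves the arrival probability of \<open>j\<close>.\<close>
    also have "\<dots> \<le> ?E (\<lambda>\<sigma>. indicator {j} (\<sigma> t))"
    proof (intro expectation_pmf_mono int)
      fix \<sigma> assume \<sigma>: "\<sigma> \<in> set_pmf (arrivals inst)"
      let ?D = "decision inst \<sigma> (\<phi> \<sigma>) t"
      have "(\<Sum>f\<in>?F. d \<sigma> t f * of_bool (fst (snd f) = j)) \<le> (\<Sum>f\<in>?F. d \<sigma> t f * indicator {j} (\<sigma> t))"
      proof (intro sum_mono)
        fix f
        show "d \<sigma> t f * of_bool (fst (snd f) = j) \<le> d \<sigma> t f * indicator {j} (\<sigma> t)"
        proof (cases "Some f \<in> set_pmf ?D")
          case True
          then have "fst (snd f) = \<sigma> t"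
            using set_decision[OF feas[OF \<sigma>] _ True] t by (simp add: assignments_online_def)
          then show ?thesis by (auto simp: indicator_def)
        next
          case False
          then have "d \<sigma> t f = 0" by (simp add: d_def pmf_eq_0_set_pmf)
          then show ?thesis by simp
        qed
      qed
      also have "\<dots> = measure_pmf.prob ?D (Some ` ?F) * indicator {j} (\<sigma> t)"
        using finite_assignments[OF valid]
        by (simp add: measure_measure_pmf_finite sum_distrib_right d_def sum.reindex)
      also have "\<dots> \<le> 1 * indicator {j} (\<sigma> t)"
        by (intro mult_right_mono) auto
      finally show "(\<Sum>f\<in>?F. d \<sigma> t f * of_bool (fst (snd f) = j)) \<le> indicator {j} (\<sigma> t)" by simp
    qed
    also have "\<dots> = measure_pmf.expectation (map_pmf (\<lambda>\<sigma>. \<sigma> t) (arrivals inst)) (indicator {j})"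
      by (simp only: integral_map_pmf)
    also have "\<dots> = pmf (arrival ?U t) j"
      using t by (simp add: map_arrivals pmf.rep_eq)
    finally show "sum (\<lambda>u. y u t) (assignments_online ?U j) \<le> pmf (arrival ?U t) j" .
  next
    fix ic assume "ic \<in> offline ?U"
    then obtain i c where ic: "ic = (i, c)" "i \<in> offline inst" "c < capacity inst i" by auto
    let ?g = "\<lambda>t f. if fst f = i then accept_prob inst f t / capacity inst i else 0"
    have "(\<Sum>t<horizon ?U. \<Sum>u\<in>assignments_offline ?U ic. y u t * accept_prob ?U u t) =
      (\<Sum>t<?T. \<Sum>f\<in>?F. \<Sum>c'<capacity inst (fst f). if c' = c then ?E (\<lambda>\<sigma>. d \<sigma> t f) * ?g t f else 0)"
      unfolding sum_assignments_offline[OF valid_unit_instance[OF valid]] sum_unit_instance[OF valid]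
      by (intro sum.cong) (auto simp: y_def ic)
    also have "\<dots> = (\<Sum>t<?T. \<Sum>f\<in>?F. ?E (\<lambda>\<sigma>. d \<sigma> t f) * ?g t f)"
      using ic by (intro sum.cong refl) auto
    also have "\<dots> = ?E (\<lambda>\<sigma>. \<Sum>t<?T. \<Sum>f\<in>?F. d \<sigma> t f * ?g t f)"
      by (simp add: int)
    \<comment> \<open>The even split divides the expected usage of \<open>i\<close>, at most
      \<open>capacity inst i\<close>, by that capacity.\<close>
    also have "\<dots> \<le> ?E (\<lambda>\<sigma>. 1)"
    proof (intro expectation_pmf_mono int)
      fix \<sigma> assume \<sigma>: "\<sigma> \<in> set_pmf (arrivals inst)"
      have "(\<Sum>t<?T. \<Sum>f\<in>?F. d \<sigma> t f * accept_prob inst f t * of_bool (fst f = i)) / capacity inst i \<le> 1"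
        using ic expected_usage_le[OF valid feas[OF \<sigma>], of i] by (simp add: divide_le_eq d_def)
      moreover have "(\<Sum>t<?T. \<Sum>f\<in>?F. d \<sigma> t f * ?g t f) =
          (\<Sum>t<?T. \<Sum>f\<in>?F. d \<sigma> t f * accept_prob inst f t * of_bool (fst f = i)) / capacity inst i"
        unfolding sum_divide_distrib by (intro sum.cong) auto
      ultimately show "(\<Sum>t<?T. \<Sum>f\<in>?F. d \<sigma> t f * ?g t f) \<le> 1" by simp
    qed
    finally show "(\<Sum>t<horizon ?U. \<Sum>u\<in>assignments_offline ?U ic. y u t * accept_prob ?U u t) \<le> 1"
      by simp
  next
    fix t u show "0 \<le> y u t" by (simp add: y_def d_def integral_nonneg)
  qed
  moreover have "lp_value ?U y = measure_pmf.expectation (clairvoyant_outcome inst \<phi>) (total_profit inst)"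
  proof -
    have "lp_value ?U y = (\<Sum>t<?T. \<Sum>u\<in>assignments ?U. y u t *
            (\<lambda>f. accept_prob inst f t * profit inst f t) (fst (fst u), snd u))"
      by (simp add: lp_value_def mult.assoc)
    also have "\<dots> = (\<Sum>t<?T. \<Sum>f\<in>?F. ?E (\<lambda>\<sigma>. d \<sigma> t f) * (accept_prob inst f t * profit inst f t))"
      by (subst sum_y) simp
    also have "\<dots> = measure_pmf.expectation (clairvoyant_outcome inst \<phi>) (total_profit inst)"
      by (simp add: expectation_profit_clairvoyant[OF assms] int d_def[symmetric] mult.assoc)
    finally show ?thesis .
  qed
  ultimately show ?thesis by (rule that)
qed

section \<open>Existence of an LP optimum and the bound on \<open>OPT_OFF\<close>\<close>

text \<open>The first bound forces \<open>x\<close> to vanish where the arrival probability is 0,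
  which makes the quotient in \<open>att_prob\<close> harmless. The second puts solutions into a
  compact box.\<close>

lemma lp_feasible_le_1:
  assumes valid: "valid_instance inst" and x: "lp_feasible inst x"
    and "f \<in> assignments inst" "t < horizon inst"
  shows "x f t \<le> pmf (arrival inst t) (fst (snd f))" "x f t \<le> 1"
proof -
  have j: "fst (snd f) \<in> online inst"
    using assms by (auto simp: valid_instance_def assignments_def)
  have "x f t \<le> sum (\<lambda>f. x f t) (assignments_online inst (fst (snd f)))"
    using assms finite_assignments[OF valid]
    by (intro member_le_sum) (auto simp: assignments_online_def lp_feasible_def)
  also have "\<dots> \<le> pmf (arrival inst t) (fst (snd f))"
    using x j assms(4) by (simp add: lp_feasible_def)
  finally show "x f t \<le> pmf (arrival inst t) (fst (snd f))" .
  then show "x f t \<le> 1" by (rule order_trans[OF _ pmf_le_1])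
qed

text \<open>The LP does not see values outside its index set, so the search for an optimum may be
  confined to functions that vanish there.\<close>

lemma lp_feasible_cong:
  assumes "\<And>f t. f \<in> assignments inst \<Longrightarrow> t < horizon inst \<Longrightarrow> x f t = y f t"
  shows "lp_feasible inst x \<longleftrightarrow> lp_feasible inst y"
proof -
  have "(\<Sum>f\<in>assignments_online inst j. x f t) = (\<Sum>f\<in>assignments_online inst j. y f t)"
    if "t < horizon inst" for j t
    using assms that by (intro sum.cong) (auto simp: assignments_online_def)
  moreover have "(\<Sum>t<horizon inst. \<Sum>f\<in>assignments_offline inst i. x f t * accept_prob inst f t) =
      (\<Sum>t<horizon inst. \<Sum>f\<in>assignments_offline inst i. y f t * accept_prob inst f t)" for i
    using assms by (intro sum.cong) (auto simp: assignments_offline_def)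
  ultimately show ?thesis using assms by (auto simp: lp_feasible_def)
qed

lemma lp_value_cong:
  assumes "\<And>f t. f \<in> assignments inst \<Longrightarrow> t < horizon inst \<Longrightarrow> x f t = y f t"
  shows "lp_value inst x = lp_value inst y"
  using assms unfolding lp_value_def by (intro sum.cong) auto

text \<open>Uncurried solutions that vanish outside the index set of the LP form a compact set in the
  product topology.\<close>

lemma lp_optimal_exists:
  assumes valid: "valid_instance inst"
  shows "\<exists>x. lp_optimal inst x"
proof -
  let ?F = "assignments inst" and ?T = "horizon inst"
  define K :: "(_ \<times> nat \<Rightarrow> real) set"
    where "K = PiE UNIV (\<lambda>z. if z \<in> ?F \<times> {..<?T} then {0..1} else {0})"
  define L where "L = {z. lp_feasible inst (curry z)}"
  have "compactin (product_topology (\<lambda>i. euclidean) UNIV) K"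
    unfolding K_def compactin_PiE by auto
  then have "compact K"
    by (simp add: euclidean_product_topology)
  moreover have "closed L"
    unfolding L_def lp_feasible_def curry_def Ball_def
    by (intro closed_Collect_conj closed_Collect_all closed_Collect_imp open_Collect_const
          closed_Collect_le continuous_on_sum continuous_on_mult continuous_on_const
          continuous_on_product_coordinates)
  ultimately have "compact (K \<inter> L)" by (rule compact_Int_closed)
  moreover have "(\<lambda>_. 0) \<in> K \<inter> L"
    by (auto simp: K_def L_def lp_feasible_def curry_def)
  moreover have "continuous_on (K \<inter> L) (\<lambda>z. lp_value inst (curry z))"
    unfolding lp_value_def curry_def
    by (intro continuous_intros continuous_on_subset[OF continuous_on_product_coordinates]) auto
  ultimately obtain z where z: "z \<in> K \<inter> L"
    and max: "\<And>z'. z' \<in> K \<inter> L \<Longrightarrow> lp_value inst (curry z') \<le> lp_value inst (curry z)"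
    using continuous_attains_sup[of "K \<inter> L" "\<lambda>z. lp_value inst (curry z)"] by blast
  have "lp_value inst y \<le> lp_value inst (curry z)" if y: "lp_feasible inst y" for y
  proof -
    \<comment> \<open>Truncating a competitor to the index set places it in the compact set without
      changing feasibility or value.\<close>
    define z' where "z' = (\<lambda>(f, t). if f \<in> ?F \<and> t < ?T then y f t else 0)"
    have eq: "y f t = curry z' f t" if "f \<in> ?F" "t < ?T" for f t
      using that by (simp add: z'_def)
    have "z' \<in> K"
      using y lp_feasible_le_1[OF valid y] by (auto simp: K_def z'_def lp_feasible_def)
    moreover have "z' \<in> L"
      using y lp_feasible_cong[of inst y "curry z'"] eq by (simp add: L_def)
    ultimately show ?thesis
      using max[of z'] lp_value_cong[of inst y "curry z'"] eq by simp
  qed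
  then show ?thesis using z unfolding lp_optimal_def L_def by blast
qed

text \<open>Rejecting always witnesses that the supremum in \<open>OPT_OFF\<close> ranges over a
  nonempty set.\<close>

lemma feasible_reject: "feasible_on inst \<sigma> (\<lambda>_ _. return_pmf (0, None))"
  by (simp add: feasible_on_def)

lemma clairvoyant_le_lp:
  assumes "valid_instance inst" "lp_optimal (unit_instance inst) x" "clairvoyant_policy inst \<phi>"
  shows "measure_pmf.expectation (clairvoyant_outcome inst \<phi>) (total_profit inst) \<le>
         lp_value (unit_instance inst) x"
  using clairvoyant_lp[OF assms(1,3)] assms(2) by (metis lp_optimal_def)

lemma OPT_OFF_le_lp:
  assumes "valid_instance inst" "lp_optimal (unit_instance inst) x"
  shows "OPT_OFF inst \<le> lp_value (unit_instance inst) x"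
  unfolding OPT_OFF_def
proof (rule cSUP_least)
  show "{\<phi>. clairvoyant_policy inst \<phi>} \<noteq> {}"
    using feasible_reject by (auto simp: clairvoyant_policy_def intro!: exI[of _ "\<lambda>_ _ _. return_pmf (0, None)"])
qed (use clairvoyant_le_lp[OF assms] in auto)

text \<open>A real supremum dominates the members of a set that is bounded above; the LP optimum is
  such a bound.\<close>

lemma clairvoyant_le_OPT_OFF:
  assumes "valid_instance inst" "clairvoyant_policy inst \<phi>"
  shows "measure_pmf.expectation (clairvoyant_outcome inst \<phi>) (total_profit inst) \<le> OPT_OFF inst"
proof -
  obtain x where x: "lp_optimal (unit_instance inst) x"
    using lp_optimal_exists[OF valid_unit_instance[OF assms(1)]] by blast
  show ?thesis
    unfolding OPT_OFF_def
    using assms clairvoyant_le_lp[OF assms(1) x]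
    by (intro cSUP_upper bdd_aboveI2[where M = "lp_value (unit_instance inst) x"]) auto
qed


section \<open>Analysis of the attenuation policy\<close>

lemma integrable_indicator_pmf [simp]: "integrable (measure_pmf M) (indicat_real A)"
  by (rule integrable_bounded_pmf[where C = 1]) (simp add: indicator_def)

text \<open>Stated for prefixes because the selection in round \<open>t\<close> involves only the
  arrivals up to \<open>t\<close>.\<close>

lemma expectation_prod_arrivals:
  assumes valid: "valid_instance inst" and n: "n \<le> horizon inst"
    and nonneg: "\<And>t j. t < n \<Longrightarrow> j \<in> set_pmf (arrival inst t) \<Longrightarrow> g t j \<ge> 0"
  shows "measure_pmf.expectation (arrivals inst) (\<lambda>\<sigma>. \<Prod>t<n. g t (\<sigma> t)) =
         (\<Prod>t<n. measure_pmf.expectation (arrival inst t) (g t) :: real)"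
proof -
  \<comment> \<open>Padding the later rounds with the factor 1 gives a product over the full index
    set of \<open>Pi_pmf\<close>.\<close>
  let ?g = "\<lambda>t. if t < n then g t else (\<lambda>_. 1)"
  have fin: "finite (set_pmf (arrival inst t))" if "t < horizon inst" for t
    using valid that by (auto simp: valid_instance_def intro: finite_subset[of _ "online inst"])
  have eq: "(\<Prod>t<n. h t) = (\<Prod>t<horizon inst. if t < n then h t else 1)" for h :: "nat \<Rightarrow> real"
    using n by (intro prod.mono_neutral_cong_left) auto
  have "measure_pmf.expectation (arrivals inst) (\<lambda>\<sigma>. \<Prod>t<n. g t (\<sigma> t)) =
        measure_pmf.expectation (arrivals inst) (\<lambda>\<sigma>. \<Prod>t<horizon inst. ?g t (\<sigma> t))"
    unfolding eq by (intro expectation_pmf_cong prod.cong) auto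
  also have "\<dots> = (\<Prod>t<horizon inst. measure_pmf.expectation (arrival inst t) (?g t))"
    unfolding arrivals_def
    by (rule expectation_prod_Pi_pmf) (auto intro!: integrable_measure_pmf_finite fin nonneg)
  also have "\<dots> = (\<Prod>t<n. measure_pmf.expectation (arrival inst t) (g t))"
    unfolding eq by (intro prod.cong) auto
  finally show ?thesis .
qed

text \<open>Survival, unlike use, is multiplicative over rounds. Sets instead of single copies are
  taken because second moments need pairs.\<close>

definition unused :: "('i \<times> nat) set \<Rightarrow> ('i, 'j) history set" where
  "unused S = {h. \<forall>(i, c)\<in>S. \<not> copy_used h i c}"

lemma copy_used_snoc:
  "copy_used (h @ [Event j m s a]) i c \<longleftrightarrow>
     copy_used h i c \<or> a \<and> m = c \<and> (\<exists>j k. s = Some (i, j, k))"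
  by (auto simp: copy_used_def)

section \<open>Attenuation weights, hitting probabilities and rates\<close>

locale att =
  fixes inst :: "('i, 'j) mpkhd" and \<gamma> :: real
    and x :: "('i \<times> nat, 'j) assignment \<Rightarrow> nat \<Rightarrow> real"
  assumes valid: "valid_instance inst"
    and lp: "lp_feasible (unit_instance inst) x"
    and gamma: "0 \<le> \<gamma>" "\<gamma> \<le> 1/2"
begin

abbreviation "U \<equiv> unit_instance inst"
abbreviation "T \<equiv> horizon inst"
abbreviation "p f t \<equiv> accept_prob U f t"
abbreviation "\<beta> \<equiv> att_beta U \<gamma> x"
abbreviation "\<alpha> \<equiv> att_prob U \<gamma> x"

definition load :: "'i \<times> nat \<Rightarrow> nat \<Rightarrow> real" where
  "load u t = (\<Sum>f\<in>assignments_offline U u. x f t * p f t)"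

text \<open>Probability, averaged over the arrival of round \<open>t\<close>, that \<open>u\<close>
  is sampled and the agent would accept, leaving availability aside. It is thus the chance that
  round \<open>t\<close> consumes \<open>u\<close> if \<open>u\<close> is still free.\<close>

definition rate :: "'i \<times> nat \<Rightarrow> nat \<Rightarrow> real" where
  "rate u t = load u t * (\<gamma> / \<beta> u t)"

text \<open>The same probability for a set of copies, conditional on the arrival of
  \<open>j\<close>. Availability is left out, which makes the quantity independent of the
  history.\<close>

definition hit :: "('i \<times> nat) set \<Rightarrow> nat \<Rightarrow> 'j \<Rightarrow> real" where
  "hit S t j = (\<Sum>f\<in>assignments_online U j. if fst f \<in> S then \<alpha> t f * p f t else 0)"

lemma validU: "valid_instance U"
  by (rule valid_unit_instance[OF valid])

lemma finU: "finite (assignments U)" "finite (assignments_online U j)" "finite (assignments_offline U u)"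
  using finite_assignments[OF validU] by (auto simp: assignments_online_def assignments_offline_def)

lemma p_bounds: "f \<in> assignments U \<Longrightarrow> t < T \<Longrightarrow> 0 \<le> p f t \<and> p f t \<le> 1"
  using validU unfolding valid_instance_def by (simp add: less_imp_le)

lemma x_nonneg: "f \<in> assignments U \<Longrightarrow> t < T \<Longrightarrow> 0 \<le> x f t"
  using lp by (simp add: lp_feasible_def)

lemma load_nonneg: "t < T \<Longrightarrow> 0 \<le> load u t"
  unfolding load_def using x_nonneg p_bounds
  by (intro sum_nonneg mult_nonneg_nonneg) (auto simp: assignments_offline_def)

text \<open>Prefixes inherit the capacity constraint because loads are nonnegative. A pair outside
  the instance has no assignments and load 0, so the bound covers every \<open>u\<close>.\<close>

lemma sum_load_le_1:
  assumes "t \<le> T"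
  shows "(\<Sum>t'<t. load u t') \<le> 1"
proof -
  have "(\<Sum>t'<t. load u t') \<le> (\<Sum>t'<T. load u t')"
    using assms load_nonneg by (intro sum_mono2) auto
  also have "\<dots> \<le> 1"
  proof (cases "u \<in> offline U")
    case True
    then show ?thesis using lp unfolding lp_feasible_def load_def by (simp only: unit_instance_sel)
  next
    case False
    then have "assignments_offline U u = {}"
      using validU by (auto simp: assignments_offline_def assignments_def valid_instance_def)
    then show ?thesis by (simp add: load_def)
  qed
  finally show ?thesis .
qed

lemma beta_load: "\<beta> u t = 1 - \<gamma> * (\<Sum>t'<t. load u t')"
  by (simp add: att_beta_def load_def)

lemma beta_bounds:
  assumes "t \<le> T"
  shows "1 - \<gamma> \<le> \<beta> u t" "\<beta> u t \<le> 1" "0 < \<beta> u t"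
proof -
  show *: "1 - \<gamma> \<le> \<beta> u t"
    using mult_left_mono[OF sum_load_le_1[OF assms, of u] gamma(1)] by (simp add: beta_load)
  show "\<beta> u t \<le> 1"
    using assms load_nonneg[of _ u] gamma by (auto simp: beta_load intro!: mult_nonneg_nonneg sum_nonneg)
  show "0 < \<beta> u t" using * gamma by linarith
qed

text \<open>Since \<open>\<beta> u t * rate u t = \<gamma> * load u t\<close>, dividing by \<beta>
  in the policy makes the survival probability drop by exactly \<gamma> times the LP load.\<close>

lemma beta_Suc: "t < T \<Longrightarrow> \<beta> u (Suc t) = \<beta> u t * (1 - rate u t)"
  using beta_bounds(3)[of t u] by (simp add: rate_def beta_load field_simps)

lemma prod_rate: "t \<le> T \<Longrightarrow> (\<Prod>t'<t. 1 - rate u t') = \<beta> u t"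
proof (induction t)
  case (Suc t)
  then show ?case by (simp add: beta_Suc)
qed (simp add: beta_load)

lemma alpha_nonneg: "f \<in> assignments U \<Longrightarrow> t < T \<Longrightarrow> 0 \<le> \<alpha> t f"
  unfolding att_prob_def using beta_bounds(3)[of t] gamma x_nonneg
  by (intro mult_nonneg_nonneg divide_nonneg_nonneg) (auto simp: less_imp_le)

text \<open>If the arrival probability is 0, the quotient in \<open>att_prob\<close> is 0 by
  convention, and feasibility forces \<open>x f t = 0\<close>, so both sides agree.\<close>

lemma pmf_alpha:
  assumes "f \<in> assignments U" "t < T"
  shows "pmf (arrival inst t) (fst (snd f)) * \<alpha> t f = x f t * (\<gamma> / \<beta> (fst f) t)"
proof (cases "pmf (arrival inst t) (fst (snd f)) = 0")
  case True
  then have "x f t = 0"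
    using lp_feasible_le_1(1)[OF validU lp assms(1), of t] x_nonneg[OF assms] assms(2) by simp
  then show ?thesis by (simp add: att_prob_def)
qed (simp add: att_prob_def)

text \<open>\<open>\<gamma> \<le> 1/2\<close> is needed for \<open>\<gamma> / \<beta> \<le> \<gamma> / (1 - \<gamma>) \<le> 1\<close>.\<close>

lemma alpha_sum_le_1:
  assumes j: "j \<in> online inst" and t: "t < T"
  shows "(\<Sum>f\<in>assignments_online U j. \<alpha> t f) \<le> 1"
proof -
  let ?q = "pmf (arrival inst t) j"
  have "(\<Sum>f\<in>assignments_online U j. \<alpha> t f) \<le> (\<Sum>f\<in>assignments_online U j. x f t / ?q)"
  proof (intro sum_mono)
    fix f assume "f \<in> assignments_online U j"
    then have f: "f \<in> assignments U" "fst (snd f) = j" by (auto simp: assignments_online_def)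
    have "\<gamma> / \<beta> (fst f) t \<le> 1"
      using beta_bounds[of t "fst f"] t gamma by (simp add: divide_le_eq)
    then have "x f t / ?q * (\<gamma> / \<beta> (fst f) t) \<le> x f t / ?q * 1"
      using x_nonneg[OF f(1) t] by (intro mult_left_mono) auto
    then show "\<alpha> t f \<le> x f t / ?q" by (simp add: att_prob_def f)
  qed
  also have "\<dots> = (\<Sum>f\<in>assignments_online U j. x f t) / ?q"
    by (simp add: sum_divide_distrib)
  also have "\<dots> \<le> 1"
  proof -
    have "(\<Sum>f\<in>assignments_online U j. x f t) \<le> ?q"
      using lp t j by (simp add: lp_feasible_def)
    then show ?thesis by (cases "?q = 0") (simp_all add: divide_le_eq order_less_le)
  qed
  finally show ?thesis .
qed

text \<open>\<open>embed_pmf\<close> returns the given weights provided that they are nonnegative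
  with total mass 1; \<open>alpha_sum_le_1\<close> makes the weight of \<open>None\<close>
  nonnegative.\<close>

lemma pmf_att_sample:
  assumes j: "j \<in> online inst" and t: "t < T"
  shows "pmf (att_sample U \<gamma> x t j) (Some f) = (if f \<in> assignments_online U j then \<alpha> t f else 0)"
proof -
  let ?F = "assignments_online U j"
  let ?g = "\<lambda>s. case s of None \<Rightarrow> 1 - (\<Sum>f\<in>?F. \<alpha> t f)
     | Some f \<Rightarrow> if f \<in> ?F then \<alpha> t f else 0"
  have nonneg: "0 \<le> ?g s" for s
    using alpha_sum_le_1[OF assms] alpha_nonneg t
    by (cases s) (auto simp: assignments_online_def)
  have "(\<integral>\<^sup>+s. ennreal (?g s) \<partial>count_space UNIV) = (\<Sum>s\<in>insert None (Some ` ?F). ennreal (?g s))"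
    using finU by (intro nn_integral_count_space') (auto split: option.splits)
  also have "\<dots> = ennreal (\<Sum>s\<in>insert None (Some ` ?F). ?g s)"
    by (intro sum_ennreal nonneg)
  also have "(\<Sum>s\<in>insert None (Some ` ?F). ?g s) = 1"
    using finU by (simp add: sum.insert_if sum.reindex)
  finally have "pmf (embed_pmf ?g) (Some f) = ?g (Some f)"
    by (intro pmf_embed_pmf nonneg) simp
  then show ?thesis by (simp add: att_sample_def)
qed

lemma set_att_sample:
  assumes "j \<in> online inst" "t < T" "Some f \<in> set_pmf (att_sample U \<gamma> x t j)"
  shows "f \<in> assignments_online U j"
  using assms pmf_att_sample[OF assms(1,2), of f] by (auto simp: set_pmf_iff split: if_splits)

lemma expectation_att_sample:
  fixes g :: "_ \<Rightarrow> real"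
  assumes "j \<in> online inst" "t < T" and g: "g None = 0"
  shows "measure_pmf.expectation (att_sample U \<gamma> x t j) g =
    (\<Sum>f\<in>assignments_online U j. g (Some f) * \<alpha> t f)"
proof -
  have "measure_pmf.expectation (att_sample U \<gamma> x t j) g =
    (\<Sum>s\<in>Some ` assignments_online U j. g s * pmf (att_sample U \<gamma> x t j) s)"
  proof (rule integral_measure_pmf_real)
    fix s assume "s \<in> set_pmf (att_sample U \<gamma> x t j)" "g s \<noteq> 0"
    then show "s \<in> Some ` assignments_online U j"
      using set_att_sample[OF assms(1,2)] g by (cases s) auto
  qed (simp add: finU)
  also have "\<dots> = (\<Sum>f\<in>assignments_online U j. g (Some f) * \<alpha> t f)"
    by (simp add: sum.reindex pmf_att_sample[OF assms(1,2)])
  finally show ?thesis .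
qed

lemma hit_bounds:
  assumes "j \<in> online inst" "t < T"
  shows "0 \<le> hit S t j" "hit S t j \<le> 1"
proof -
  have f: "0 \<le> \<alpha> t f * p f t" "\<alpha> t f * p f t \<le> \<alpha> t f" "0 \<le> \<alpha> t f"
    if "f \<in> assignments_online U j" for f
    using that alpha_nonneg[of f t] p_bounds[of f t] assms(2)
    by (auto simp: assignments_online_def mult_left_le)
  show "0 \<le> hit S t j" unfolding hit_def using f by (intro sum_nonneg) auto
  have "hit S t j \<le> (\<Sum>f\<in>assignments_online U j. \<alpha> t f)"
    unfolding hit_def using f by (intro sum_mono) auto
  then show "hit S t j \<le> 1" using alpha_sum_le_1[OF assms] by linarith
qed

section \<open>The policy on the original instance and its feasibility\<close>

text \<open>The history-dependent availability check, separated from the sampling, whose law depends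
  on the round and the arrival but not on past outcomes.\<close>

definition respond :: "('i, 'j) history \<Rightarrow> ('i \<times> nat, 'j) assignment option \<Rightarrow> nat \<times> ('i, 'j) assignment option"
  where "respond h s = (case s of
         None \<Rightarrow> (0, None)
       | Some ((i, c), j', k) \<Rightarrow> if copy_used h i c then (0, None) else (c, Some (i, j', k)))"

lemma ATT_respond: "ATT inst \<gamma> x h j = map_pmf (respond h) (att_sample U \<gamma> x (length h) j)"
  unfolding ATT_def by (intro map_pmf_cong refl) (simp add: respond_def)

lemma set_ATT:
  assumes "length h < T" "j \<in> online inst" "(m, Some f) \<in> set_pmf (ATT inst \<gamma> x h j)"
  shows "f \<in> assignments_online inst j" "m < capacity inst (fst f)" "fst f \<in> offline inst"
    "\<not> copy_used h (fst f) m"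
proof -
  from assms(3) obtain s where s: "s \<in> set_pmf (att_sample U \<gamma> x (length h) j)" "respond h s = (m, Some f)"
    by (auto simp: ATT_respond)
  then obtain i c j' k where "s = Some ((i, c), j', k)" "m = c" "f = (i, j', k)" "\<not> copy_used h i c"
    by (auto simp: respond_def split: option.splits if_splits)
  moreover from this s have "((i, c), j', k) \<in> assignments_online U j"
    using set_att_sample assms by blast
  ultimately show "f \<in> assignments_online inst j" "m < capacity inst (fst f)" "fst f \<in> offline inst"
    "\<not> copy_used h (fst f) m"
    using valid by (auto simp: assignments_online_def assignments_def valid_instance_def)
qed

text \<open>The availability check lets each copy succeed at most once, so counting accepted rounds
  is the same as counting used copies. This links the original instance, where the policy acts, with
  the copies.\<close>

lemma ATT_invariant:
  assumes \<sigma>: "\<And>t. t < T \<Longrightarrow> \<sigma> t \<in> online inst"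
    and "n \<le> T" "h \<in> set_pmf (play inst \<sigma> (ATT inst \<gamma> x) n)"
  shows "{(i, c). copy_used h i c} \<subseteq> offline U"
    and "used_capacity h i = card {c. copy_used h i c}"
    and "num_successes h = card {(i, c). copy_used h i c}"
proof -
  have finO: "finite (offline U)" using validU by (simp add: valid_instance_def)
  have "{(i, c). copy_used h i c} \<subseteq> offline U \<and> used_capacity h i = card {c. copy_used h i c} \<and>
     num_successes h = card {(i, c). copy_used h i c}"
    using assms(2,3)
  proof (induction n arbitrary: h)
    case 0
    then show ?case by (simp add: used_capacity_def num_successes_def copy_used_def)
  next
    case (Suc n)
    from Suc.prems(2) obtain h' m s a where h': "h' \<in> set_pmf (play inst \<sigma> (ATT inst \<gamma> x) n)"
      "(m, s) \<in> set_pmf (ATT inst \<gamma> x h' (\<sigma> n))" "a \<in> set_pmf (acceptance inst n s)"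
      and h: "h = h' @ [Event (\<sigma> n) m s a]"
      unfolding set_play_Suc by blast
    have IH: "{(i, c). copy_used h' i c} \<subseteq> offline U" "used_capacity h' i = card {c. copy_used h' i c}"
      "num_successes h' = card {(i, c). copy_used h' i c}"
      using Suc.IH[OF _ h'(1)] Suc.prems(1) by auto
    have len: "length h' = n" using h'(1) by (rule length_play)
    show ?case
    proof (cases a)
      case False
      then show ?thesis using IH by (simp add: h copy_used_snoc used_capacity_def num_successes_def)
    next
      case True
      with h'(3) obtain i' j' k' where s: "s = Some (i', j', k')"
        by (cases s) (auto simp: acceptance_def)
      have new: "(i', m) \<in> offline U" "\<not> copy_used h' i' m"
        using set_ATT[of h' "\<sigma> n" m "(i', j', k')"] h'(2) s \<sigma>[of n] len Suc.prems(1) by auto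
      have used: "copy_used h i c \<longleftrightarrow> copy_used h' i c \<or> i = i' \<and> c = m" for i c
        using True s by (auto simp: h copy_used_snoc)
      \<comment> \<open>The consumed copy was free before, so the set and the success counter both
        grow by exactly one.\<close>
      have all: "{(i, c). copy_used h i c} = insert (i', m) {(i, c). copy_used h' i c}"
        using used by auto
      have fin: "finite {(i, c). copy_used h' i c}" using IH(1) finO by (rule finite_subset)
      have fini: "finite {c. copy_used h' i c}"
        by (rule finite_subset[OF _ finite_imageI[OF fin, of snd]]) force
      have "{c. copy_used h i c} = (if i = i' then insert m {c. copy_used h' i c} else {c. copy_used h' i c})"
        using used by auto
      then have "used_capacity h i = card {c. copy_used h i c}"
        using IH(2) fini new True s by (auto simp: used_capacity_def h)
      moreover have "num_successes h = card {(i, c). copy_used h i c}"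
        unfolding all using IH(3) fin new True by (simp add: num_successes_def h)
      ultimately show ?thesis using IH(1) new all by simp
    qed
  qed
  then show "{(i, c). copy_used h i c} \<subseteq> offline U"
    and "used_capacity h i = card {c. copy_used h i c}"
    and "num_successes h = card {(i, c). copy_used h i c}"
    by blast+
qed

lemma online_policy_ATT: "online_policy inst (ATT inst \<gamma> x)"
  unfolding online_policy_def feasible_on_def
proof (intro ballI allI impI conjI)
  fix \<sigma> t h m f
  assume \<sigma>: "\<sigma> \<in> set_pmf (arrivals inst)" and t: "t < T"
    and h: "h \<in> set_pmf (play inst \<sigma> (ATT inst \<gamma> x) t)"
    and mf: "(m, Some f) \<in> set_pmf (ATT inst \<gamma> x h (\<sigma> t))"
  have on: "\<sigma> t \<in> online inst" if "t < T" for t using arrival_online[OF valid \<sigma> that] .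
  have len: "length h < T" using length_play[OF h] t by simp
  note new = set_ATT[OF len on[OF t] mf]
  show "f \<in> assignments_online inst (\<sigma> t)" by (rule new(1))
  note inv = ATT_invariant[OF on less_imp_le[OF t] h]
  \<comment> \<open>The sampled copy \<open>m\<close> is still free, so the used copies of its type
    miss at least one.\<close>
  have "{c. copy_used h (fst f) c} \<subseteq> {..<capacity inst (fst f)} - {m}"
    using inv(1) new(4) by auto
  then have "card {c. copy_used h (fst f) c} \<le> card ({..<capacity inst (fst f)} - {m})"
    by (intro card_mono) auto
  then show "used_capacity h (fst f) < capacity inst (fst f)"
    using inv(2)[of "fst f"] new(2) by (simp add: card_Diff_singleton)
qed

section \<open>Survival probabilities of sets of copies\<close>

lemma prob_unused_Suc:
  assumes j: "\<sigma> t \<in> online inst" and t: "t < T"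
  shows "measure_pmf.prob (play inst \<sigma> (ATT inst \<gamma> x) (Suc t)) (unused S) =
         measure_pmf.prob (play inst \<sigma> (ATT inst \<gamma> x) t) (unused S) * (1 - hit S t (\<sigma> t))"
proof -
  let ?j = "\<sigma> t" and ?P = "play inst \<sigma> (ATT inst \<gamma> x) t"
  let ?s = "att_sample U \<gamma> x t ?j"
  \<comment> \<open>The second half of a round: acceptance and recording, once memo and selection
    are fixed.\<close>
  define K where "K h ms = bind_pmf (acceptance inst t (snd ms)) (\<lambda>a. return_pmf (h @ [Event ?j (fst ms) (snd ms) a]))"
    for h :: "('i, 'j) history" and ms
  define g where "g s = (case s of None \<Rightarrow> 0 | Some f \<Rightarrow> if fst f \<in> S then p f t else 0)"
    for s :: "('i \<times> nat, 'j) assignment option"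
  have K: "measure_pmf.prob (K h (respond h s)) (unused S) = indicator (unused S) h * (1 - g s)"
    if s: "s \<in> set_pmf ?s" for h s
  proof (cases s)
    case None
    then show ?thesis
      by (simp add: K_def respond_def g_def acceptance_def bind_return_pmf unused_def copy_used_snoc
          indicator_def split: prod.splits)
  next
    case (Some f)
    obtain i c j' k where f: "f = ((i, c), j', k)" by (metis prod.collapse)
    have "f \<in> assignments U" using set_att_sample[OF j t] s Some by (auto simp: assignments_online_def)
    then have pb: "0 \<le> accept_prob inst (i, j', k) t" "accept_prob inst (i, j', k) t \<le> 1"
      using p_bounds[of f t] t f by auto
    show ?thesis
    proof (cases "copy_used h i c")
      case True
      then show ?thesis using f Some
        by (auto simp: K_def respond_def g_def acceptance_def bind_return_pmf unused_def copy_used_snoc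
            indicator_def split: prod.splits)
    next
      case False
      have "measure_pmf.prob (K h (respond h s)) (unused S) =
        accept_prob inst (i, j', k) t * indicator (unused S) (h @ [Event ?j c (Some (i, j', k)) True]) +
        (1 - accept_prob inst (i, j', k) t) * indicator (unused S) (h @ [Event ?j c (Some (i, j', k)) False])"
        using False f Some pb
        by (simp add: K_def respond_def acceptance_def prob_bind_pmf)
      also have "\<dots> = indicator (unused S) h * (1 - g s)"
        using f Some by (auto simp: g_def unused_def copy_used_snoc indicator_def split: prod.splits)
      finally show ?thesis .
    qed
  qed
  have "measure_pmf.expectation ?s g = hit S t ?j"
    unfolding hit_def by (subst expectation_att_sample[OF j t]) (auto simp: g_def intro!: sum.cong)
  moreover have "integrable (measure_pmf ?s) g"
  proof (rule integrable_bounded_pmf[where C = 1])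
    fix s assume s: "s \<in> set_pmf ?s"
    show "\<bar>g s\<bar> \<le> 1"
    proof (cases s)
      case (Some f)
      then have "f \<in> assignments U" using set_att_sample[OF j t] s by (auto simp: assignments_online_def)
      then show ?thesis using p_bounds[of f t] t Some by (simp add: g_def del: unit_instance_sel)
    qed (simp add: g_def)
  qed
  ultimately have E: "measure_pmf.expectation ?s (\<lambda>s. 1 - g s) = 1 - hit S t ?j"
    by (subst Bochner_Integration.integral_diff) auto
  have "measure_pmf.prob (play inst \<sigma> (ATT inst \<gamma> x) (Suc t)) (unused S) =
    measure_pmf.expectation ?P (\<lambda>h. measure_pmf.prob (bind_pmf (ATT inst \<gamma> x h ?j) (K h)) (unused S))"
    by (simp add: prob_bind_pmf K_def case_prod_unfold)
  also have "\<dots> = measure_pmf.expectation ?P (\<lambda>h. indicator (unused S) h * (1 - hit S t ?j))"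
  proof (rule expectation_pmf_cong)
    fix h assume "h \<in> set_pmf ?P"
    then have "length h = t" by (rule length_play)
    then have "measure_pmf.prob (bind_pmf (ATT inst \<gamma> x h ?j) (K h)) (unused S) =
      measure_pmf.expectation ?s (\<lambda>s. measure_pmf.prob (K h (respond h s)) (unused S))"
      by (simp add: ATT_respond bind_map_pmf prob_bind_pmf)
    also have "\<dots> = measure_pmf.expectation ?s (\<lambda>s. indicator (unused S) h * (1 - g s))"
      by (intro expectation_pmf_cong K)
    also have "\<dots> = indicator (unused S) h * (1 - hit S t ?j)"
      by (simp only: integral_mult_right_zero E)
    finally show "measure_pmf.prob (bind_pmf (ATT inst \<gamma> x h ?j) (K h)) (unused S) =
      indicator (unused S) h * (1 - hit S t ?j)" .
  qed
  finally show ?thesis by simp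
qed

lemma prob_unused_play:
  assumes "\<And>t. t < T \<Longrightarrow> \<sigma> t \<in> online inst" "n \<le> T"
  shows "measure_pmf.prob (play inst \<sigma> (ATT inst \<gamma> x) n) (unused S) = (\<Prod>t<n. 1 - hit S t (\<sigma> t))"
  using assms(2)
proof (induction n)
  case 0
  show ?case by (simp add: unused_def copy_used_def indicator_def)
next
  case (Suc n)
  then show ?case using prob_unused_Suc[of \<sigma> n S] assms(1) by (simp del: play.simps(2))
qed

text \<open>Averaging over arrivals cancels the division by the arrival probability in \<alpha>. The
  events for different copies are disjoint, so their rates add.\<close>

lemma expectation_hit:
  assumes t: "t < T" and S: "finite S"
  shows "measure_pmf.expectation (arrival inst t) (\<lambda>j. 1 - hit S t j) = 1 - (\<Sum>u\<in>S. rate u t)"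
proof -
  have sub: "set_pmf (arrival inst t) \<subseteq> online inst" and fin: "finite (online inst)"
    using valid t by (auto simp: valid_instance_def)
  have int: "integrable (measure_pmf (arrival inst t)) (hit S t)"
    using finite_subset[OF sub fin] by (rule integrable_measure_pmf_finite)
  have "measure_pmf.expectation (arrival inst t) (hit S t) =
        (\<Sum>j\<in>online inst. hit S t j * pmf (arrival inst t) j)"
    using sub fin by (intro integral_measure_pmf_real) auto
  also have "\<dots> = (\<Sum>j\<in>online inst. \<Sum>f\<in>assignments U. if j = fst (snd f) then
       (if fst f \<in> S then pmf (arrival inst t) (fst (snd f)) * \<alpha> t f * p f t else 0) else 0)"
    unfolding hit_def sum_assignments_online[OF validU] sum_distrib_right
    by (intro sum.cong refl) auto
  also have "\<dots> = (\<Sum>f\<in>assignments U. if fst f \<in> S then pmf (arrival inst t) (fst (snd f)) * \<alpha> t f * p f t else 0)"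
  proof (subst sum.swap, intro sum.cong refl)
    fix f assume "f \<in> assignments U"
    then have "fst (snd f) \<in> online inst"
      using valid by (auto simp: assignments_def valid_instance_def)
    then show "(\<Sum>j\<in>online inst. if j = fst (snd f) then
        (if fst f \<in> S then pmf (arrival inst t) (fst (snd f)) * \<alpha> t f * p f t else 0) else 0) =
       (if fst f \<in> S then pmf (arrival inst t) (fst (snd f)) * \<alpha> t f * p f t else 0)"
      using fin by simp
  qed
  also have "\<dots> = (\<Sum>f\<in>assignments U. \<Sum>u\<in>S. if u = fst f then x f t * p f t * (\<gamma> / \<beta> u t) else 0)"
    using S t by (intro sum.cong refl) (auto simp: pmf_alpha)
  also have "\<dots> = (\<Sum>u\<in>S. \<Sum>f\<in>assignments U. (if fst f = u then x f t * p f t else 0) * (\<gamma> / \<beta> u t))"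
    by (subst sum.swap, intro sum.cong refl) auto
  also have "\<dots> = (\<Sum>u\<in>S. rate u t)"
    by (simp only: rate_def load_def sum_assignments_offline[OF validU] sum_distrib_right)
  finally show ?thesis using int by simp
qed

lemma arrival_subset: "t < T \<Longrightarrow> set_pmf (arrival inst t) \<subseteq> online inst"
  using valid by (simp add: valid_instance_def)

text \<open>The complement to 1 is the probability that the round spares \<open>S\<close>, an
  average of nonnegative terms.\<close>

lemma sum_rate_le_1:
  assumes "t < T" "finite S"
  shows "(\<Sum>u\<in>S. rate u t) \<le> 1"
proof -
  have "0 \<le> measure_pmf.expectation (arrival inst t) (\<lambda>j. 1 - hit S t j)"
    using hit_bounds assms arrival_subset[OF assms(1)]
    by (intro integral_nonneg_AE) (auto simp: AE_measure_pmf_iff subset_iff)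
  then show ?thesis using expectation_hit[OF assms] by simp
qed

lemma prob_unused:
  assumes S: "finite S"
  shows "measure_pmf.prob (outcome inst (ATT inst \<gamma> x)) (unused S) = (\<Prod>t<T. 1 - (\<Sum>u\<in>S. rate u t))"
proof -
  have "measure_pmf.prob (outcome inst (ATT inst \<gamma> x)) (unused S) =
        measure_pmf.expectation (arrivals inst) (\<lambda>\<sigma>. \<Prod>t<T. 1 - hit S t (\<sigma> t))"
    unfolding outcome_def prob_bind_pmf
    by (intro expectation_pmf_cong prob_unused_play arrival_online[OF valid]) auto
  also have "\<dots> = (\<Prod>t<T. measure_pmf.expectation (arrival inst t) (\<lambda>j. 1 - hit S t j))"
    using hit_bounds arrival_subset by (intro expectation_prod_arrivals valid) (auto simp: subset_iff)
  also have "\<dots> = (\<Prod>t<T. 1 - (\<Sum>u\<in>S. rate u t))"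
    using expectation_hit S by (intro prod.cong) auto
  finally show ?thesis .
qed

text \<open>Selecting \<open>f\<close> means sampling one of its copies while it is free. Samples of
  different copies are disjoint, and the sample is independent of the history that decides
  availability.\<close>

lemma pmf_decision_ATT:
  assumes j: "\<sigma> t \<in> online inst" and t: "t < T" and f: "f \<in> assignments inst"
  shows "pmf (decision inst \<sigma> (ATT inst \<gamma> x) t) (Some f) =
    (\<Sum>c<capacity inst (fst f). measure_pmf.prob (play inst \<sigma> (ATT inst \<gamma> x) t) (unused {(fst f, c)}) *
       (if fst (snd f) = \<sigma> t then \<alpha> t ((fst f, c), snd f) else 0))"
proof -
  let ?P = "play inst \<sigma> (ATT inst \<gamma> x) t" and ?s = "att_sample U \<gamma> x t (\<sigma> t)"
  let ?C = "{..<capacity inst (fst f)}" and ?u = "\<lambda>c. ((fst f, c), snd f)"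
  have "pmf (map_pmf snd (ATT inst \<gamma> x h (\<sigma> t))) (Some f) =
      (\<Sum>c\<in>?C. indicator (unused {(fst f, c)}) h * (if fst (snd f) = \<sigma> t then \<alpha> t (?u c) else 0))"
    if "h \<in> set_pmf ?P" for h
  proof -
    have "length h = t" using that by (rule length_play)
    then have "pmf (map_pmf snd (ATT inst \<gamma> x h (\<sigma> t))) (Some f) =
        measure_pmf.expectation ?s (indicator {s. snd (respond h s) = Some f})"
      by (simp add: ATT_respond pmf.map_comp pmf_map vimage_def)
    also have "\<dots> = (\<Sum>s\<in>Some ` ?u ` ?C. indicator {s. snd (respond h s) = Some f} s * pmf ?s s)"
    proof (rule integral_measure_pmf_real)
      fix s assume s: "s \<in> set_pmf ?s" "indicator {s. snd (respond h s) = Some f} s \<noteq> (0::real)"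
      then obtain c where c: "s = Some (?u c)"
        by (auto simp: respond_def indicator_def split: option.splits if_splits)
      then have "?u c \<in> assignments_online U (\<sigma> t)" using set_att_sample[OF j t] s by blast
      then show "s \<in> Some ` ?u ` ?C" using c by (auto simp: assignments_online_def assignments_def)
    qed simp
    also have "\<dots> = (\<Sum>c\<in>?C. indicator {s. snd (respond h s) = Some f} (Some (?u c)) * pmf ?s (Some (?u c)))"
      unfolding image_image by (subst sum.reindex) (simp_all add: inj_on_def)
    also have "\<dots> = (\<Sum>c\<in>?C. indicator (unused {(fst f, c)}) h * (if fst (snd f) = \<sigma> t then \<alpha> t (?u c) else 0))"
      using f by (intro sum.cong refl)
        (auto simp: pmf_att_sample[OF j t] respond_def unused_def indicator_def
          assignments_online_def assignments_def split: prod.splits)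
    finally show ?thesis .
  qed
  then have "pmf (decision inst \<sigma> (ATT inst \<gamma> x) t) (Some f) = measure_pmf.expectation ?P
      (\<lambda>h. \<Sum>c\<in>?C. indicator (unused {(fst f, c)}) h * (if fst (snd f) = \<sigma> t then \<alpha> t (?u c) else 0))"
    unfolding decision_def pmf_bind by (intro expectation_pmf_cong)
  also have "\<dots> = (\<Sum>c\<in>?C. measure_pmf.prob ?P (unused {(fst f, c)}) *
       (if fst (snd f) = \<sigma> t then \<alpha> t (?u c) else 0))"
    by (subst Bochner_Integration.integral_sum) simp_all
  finally show ?thesis .
qed

text \<open>An identity for every feasible \<open>x\<close>; optimality enters when the LP value is
  compared with \<open>OPT_OFF\<close>.\<close>

lemma expected_profit_ATT: "expected_profit inst (ATT inst \<gamma> x) = \<gamma> * lp_value U x"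
proof -
  let ?E = "measure_pmf.expectation (arrivals inst)"
  let ?h = "\<lambda>u t \<sigma>. (\<Prod>t'<t. 1 - hit {u} t' (\<sigma> t'))"
  have int: "integrable (measure_pmf (arrivals inst)) g" for g :: "_ \<Rightarrow> real"
    by (intro integrable_measure_pmf_finite finite_set_arrivals valid)
  have E: "?E (\<lambda>\<sigma>. ?h (fst u) t \<sigma> * (if fst (snd u) = \<sigma> t then \<alpha> t u else 0)) = \<gamma> * x u t"
    if u: "u \<in> assignments U" and t: "t < T" for u t
  proof -
    let ?j = "fst (snd u)"
    \<comment> \<open>Coding the arrival of \<open>?j\<close> as the factor of round
      \<open>t\<close> makes the integrand a product with one factor per arrival, so independence
      applies.\<close>
    let ?g = "\<lambda>t' j. if t' = t then of_bool (?j = j) else 1 - hit {fst u} t' j"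
    have "?E (\<lambda>\<sigma>. ?h (fst u) t \<sigma> * (if ?j = \<sigma> t then \<alpha> t u else 0)) =
          ?E (\<lambda>\<sigma>. \<alpha> t u * (\<Prod>t'<Suc t. ?g t' (\<sigma> t')))"
      by (intro expectation_pmf_cong) (simp add: of_bool_def)
    also have "\<dots> = \<alpha> t u * (\<Prod>t'<Suc t. measure_pmf.expectation (arrival inst t') (?g t'))"
    proof -
      have "0 \<le> ?g t' j" if "t' < Suc t" "j \<in> set_pmf (arrival inst t')" for t' j
        using that t hit_bounds(2)[of j t' "{fst u}"] arrival_subset[of t'] by auto
      then show ?thesis
        unfolding integral_mult_right_zero using t by (subst expectation_prod_arrivals[OF valid]) auto
    qed
    also have "(\<Prod>t'<Suc t. measure_pmf.expectation (arrival inst t') (?g t')) =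
        (\<Prod>t'<t. 1 - rate (fst u) t') * measure_pmf.expectation (arrival inst t) (indicator {?j})"
    proof -
      have "(\<Prod>t'<t. measure_pmf.expectation (arrival inst t') (?g t')) = (\<Prod>t'<t. 1 - rate (fst u) t')"
        using t expectation_hit[of _ "{fst u}"] by (intro prod.cong) auto
      moreover have "measure_pmf.expectation (arrival inst t) (?g t) =
          measure_pmf.expectation (arrival inst t) (indicator {?j})"
        by (intro expectation_pmf_cong) (auto simp: indicator_def)
      ultimately show ?thesis by simp
    qed
    \<comment> \<open>Survival has probability \<beta>, which cancels the \<beta> in \<alpha>; the
      arrival probability cancels by \<open>pmf_alpha\<close>.\<close>
    also have "\<alpha> t u * \<dots> = \<gamma> * x u t"
      using pmf_alpha[OF u t] beta_bounds(3)[of t "fst u"] t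
      by (simp add: prod_rate pmf.rep_eq field_simps)
    finally show ?thesis .
  qed
  have "expected_profit inst (ATT inst \<gamma> x) =
    ?E (\<lambda>\<sigma>. \<Sum>t<T. \<Sum>f\<in>assignments inst.
      pmf (decision inst \<sigma> (ATT inst \<gamma> x) t) (Some f) * accept_prob inst f t * profit inst f t)"
    using expectation_profit_clairvoyant[OF valid] online_policy_ATT
    by (simp add: expected_profit_def outcome_eq_clairvoyant online_policy_eq_clairvoyant)
  also have "\<dots> = ?E (\<lambda>\<sigma>. \<Sum>t<T. \<Sum>u\<in>assignments U.
      ?h (fst u) t \<sigma> * (if fst (snd u) = \<sigma> t then \<alpha> t u else 0) * (p u t * profit U u t))"
  proof (intro expectation_pmf_cong sum.cong refl)
    fix \<sigma> t assume \<sigma>: "\<sigma> \<in> set_pmf (arrivals inst)" and "t \<in> {..<T}"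
    then have t: "t < T" by simp
    have on: "\<sigma> t \<in> online inst" if "t < T" for t using arrival_online[OF valid \<sigma> that] .
    show "(\<Sum>f\<in>assignments inst.
        pmf (decision inst \<sigma> (ATT inst \<gamma> x) t) (Some f) * accept_prob inst f t * profit inst f t) =
      (\<Sum>u\<in>assignments U. ?h (fst u) t \<sigma> * (if fst (snd u) = \<sigma> t then \<alpha> t u else 0) *
        (p u t * profit U u t))"
      unfolding sum_unit_instance[OF valid]
      using prob_unused_play[of \<sigma> t, OF on] t
      by (intro sum.cong refl)
         (simp add: pmf_decision_ATT[of \<sigma> t, OF on[OF t] t] sum_distrib_right mult.assoc)
  qed
  also have "\<dots> = (\<Sum>t<T. \<Sum>u\<in>assignments U. \<gamma> * x u t * (p u t * profit U u t))"
    using E by (subst Bochner_Integration.integral_sum, simp add: int)+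
      (intro sum.cong refl, simp add: int)
  also have "\<dots> = \<gamma> * lp_value U x"
    by (simp add: lp_value_def sum_distrib_left mult.assoc)
  finally show ?thesis .
qed

section \<open>Variance of the number of successes\<close>

lemma variance_ATT:
  "variance_successes inst (ATT inst \<gamma> x) =
    (\<Sum>u\<in>offline U. \<Sum>v\<in>offline U.
      (\<Prod>t<T. 1 - (\<Sum>w\<in>{u, v}. rate w t)) - \<beta> u T * \<beta> v T)"
proof -
  let ?M = "outcome inst (ATT inst \<gamma> x)" and ?O = "offline U"
  let ?E = "measure_pmf.expectation ?M"
  define V where "V h = (\<Sum>u\<in>?O. indicator (unused {u}) h :: real)" for h :: "('i, 'j) history"
  have finO: "finite ?O" using validU by (simp add: valid_instance_def)
  have H: "real (num_successes h) = card ?O - V h" if "h \<in> set_pmf ?M" for h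
  proof -
    from that obtain \<sigma> where \<sigma>: "\<sigma> \<in> set_pmf (arrivals inst)"
      and h: "h \<in> set_pmf (play inst \<sigma> (ATT inst \<gamma> x) T)" by (auto simp: outcome_def)
    note inv = ATT_invariant[OF arrival_online[OF valid \<sigma>] order_refl h]
    have "V h = real (card {u \<in> ?O. h \<in> unused {u}})"
      using finO by (simp add: V_def indicator_def sum.If_cases Int_def)
    also have "{u \<in> ?O. h \<in> unused {u}} = ?O - {(i, c). copy_used h i c}"
      by (auto simp: unused_def)
    also have "real (card \<dots>) = real (card ?O) - real (card {(i, c). copy_used h i c})"
      using inv(1) finO by (simp add: card_Diff_subset finite_subset card_mono)
    finally show ?thesis using inv(3) by simp
  qed
  have VB: "\<bar>V h\<bar> \<le> card ?O" for h
    unfolding V_def using sum_mono[of ?O "\<lambda>u. indicator (unused {u}) h" "\<lambda>_. 1::real"]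
    by (simp add: indicator_def sum_nonneg)
  have int: "integrable (measure_pmf ?M) V" by (rule integrable_bounded_pmf) (rule VB)
  have int2: "integrable (measure_pmf ?M) (\<lambda>h. (V h)\<^sup>2)"
    by (rule integrable_bounded_pmf[where C = "(real (card ?O))\<^sup>2"])
       (use VB in \<open>simp add: abs_le_square_iff[symmetric] del: unit_instance_sel\<close>)
  have EV: "?E V = (\<Sum>u\<in>?O. \<beta> u T)"
    unfolding V_def by (subst Bochner_Integration.integral_sum) (simp_all add: prob_unused prod_rate)
  have "variance_successes inst (ATT inst \<gamma> x) = ?E (\<lambda>h. (V h - ?E V)\<^sup>2)"
  proof -
    have "?E (\<lambda>h. real (num_successes h)) = ?E (\<lambda>h. card ?O - V h)"
      by (intro expectation_pmf_cong H)
    also have "\<dots> = card ?O - ?E V" using int by simp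
    finally have m: "?E (\<lambda>h. real (num_successes h)) = card ?O - ?E V" .
    show ?thesis
      unfolding variance_successes_def m using H
      by (intro expectation_pmf_cong) (simp add: power2_commute)
  qed
  also have "\<dots> = ?E (\<lambda>h. (V h)\<^sup>2) - (?E V)\<^sup>2"
    by (rule measure_pmf.variance_eq[OF int int2])
  also have "?E (\<lambda>h. (V h)\<^sup>2) = ?E (\<lambda>h. \<Sum>u\<in>?O. \<Sum>v\<in>?O. indicator (unused {u, v}) h)"
    unfolding V_def power2_eq_square sum_product
    by (intro expectation_pmf_cong sum.cong refl) (auto simp: indicator_def unused_def)
  also have "\<dots> = (\<Sum>u\<in>?O. \<Sum>v\<in>?O. \<Prod>t<T. 1 - (\<Sum>w\<in>{u, v}. rate w t))"
    by (simp add: prob_unused del: unit_instance_sel)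
  finally show ?thesis
    by (simp add: EV power2_eq_square sum_product sum_subtractf del: unit_instance_sel)
qed

lemma variance_diagonal:
  "(\<Prod>t<T. 1 - (\<Sum>w\<in>{u, u}. rate w t)) - \<beta> u T * \<beta> u T = \<beta> u T * (1 - \<beta> u T)"
  by (simp add: prod_rate algebra_simps)

lemma rate_nonneg: "t < T \<Longrightarrow> 0 \<le> rate u t"
  unfolding rate_def using load_nonneg[of t u] gamma beta_bounds(3)[of t u] by simp

text \<open>A round can use up at most one copy, so copies stay unused with negative correlation.\<close>

lemma variance_off_diagonal:
  assumes "u \<noteq> v"
  shows "(\<Prod>t<T. 1 - (\<Sum>w\<in>{u, v}. rate w t)) \<le> \<beta> u T * \<beta> v T"
proof -
  have "(\<Prod>t<T. 1 - (\<Sum>w\<in>{u, v}. rate w t)) \<le> (\<Prod>t<T. (1 - rate u t) * (1 - rate v t))"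
  proof (intro prod_mono conjI)
    fix t assume "t \<in> {..<T}"
    then have t: "t < T" by simp
    show "0 \<le> 1 - (\<Sum>w\<in>{u, v}. rate w t)" using sum_rate_le_1[OF t, of "{u, v}"] by simp
    \<comment> \<open>The two sides differ by \<open>rate u t * rate v t\<close>.\<close>
    show "1 - (\<Sum>w\<in>{u, v}. rate w t) \<le> (1 - rate u t) * (1 - rate v t)"
      using assms mult_nonneg_nonneg[OF rate_nonneg[OF t, of u] rate_nonneg[OF t, of v]]
      by (simp add: algebra_simps)
  qed
  then show ?thesis by (simp add: prod.distrib prod_rate)
qed

lemma card_offline_unit: "card (offline U) = total_capacity inst"
  using valid by (simp add: total_capacity_def valid_instance_def)

lemma variance_ATT_le:
  "variance_successes inst (ATT inst \<gamma> x) \<le> \<gamma> * (1 - \<gamma>) * real (total_capacity inst)"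
proof -
  let ?O = "offline U"
  have finO: "finite ?O" using validU by (simp add: valid_instance_def)
  have diag: "\<beta> u T * (1 - \<beta> u T) \<le> \<gamma> * (1 - \<gamma>)" for u
  proof -
    \<comment> \<open>The product expands to
      \<open>\<gamma> * (1 - \<gamma>) - \<beta> u T * (1 - \<beta> u T)\<close>; its second factor
      is nonnegative because \<open>\<beta> u T \<ge> 1 - \<gamma> \<ge> \<gamma>\<close>.\<close>
    have "0 \<le> (\<beta> u T - (1 - \<gamma>)) * (\<beta> u T - \<gamma>)"
      using beta_bounds[of T u] gamma by (intro mult_nonneg_nonneg) auto
    then show ?thesis by (simp add: algebra_simps)
  qed
  have "variance_successes inst (ATT inst \<gamma> x) \<le>
      (\<Sum>u\<in>?O. \<Sum>v\<in>?O. if v = u then \<gamma> * (1 - \<gamma>) else 0)"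
    unfolding variance_ATT
  proof (intro sum_mono)
    fix u v
    show "(\<Prod>t<T. 1 - (\<Sum>w\<in>{u, v}. rate w t)) - \<beta> u T * \<beta> v T \<le>
        (if v = u then \<gamma> * (1 - \<gamma>) else 0)"
      using variance_diagonal[of u] diag[of u] variance_off_diagonal[of u v] by auto
  qed
  also have "\<dots> = \<gamma> * (1 - \<gamma>) * real (card ?O)"
    using finO by simp
  finally show ?thesis by (simp only: card_offline_unit)
qed

end


section \<open>Extremal instances\<close>

text \<open>Round \<open>t\<close> certainly brings the only partner of agent \<open>t\<close>. The
  LP fully loads every copy and no round can touch two copies, so the diagonal and the off-diagonal
  estimates of the variance both become equalities. The case \<open>B = 1\<close> is the tight
  instance for the profit.\<close>

definition diagonal_instance :: "nat \<Rightarrow> (nat, nat) mpkhd" where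
  "diagonal_instance B = \<lparr>offline = {..<B}, online = {..<B}, edges = (\<lambda>t. (t, t)) ` {..<B},
     num_prices = 1, price = (\<lambda>_. 0), capacity = (\<lambda>_. 1), horizon = B, arrival = return_pmf,
     accept_prob = (\<lambda>_ _. 1), profit = (\<lambda>_ _. 1)\<rparr>"

lemma diagonal_instance_sel [simp]:
  "offline (diagonal_instance B) = {..<B}" "online (diagonal_instance B) = {..<B}"
  "capacity (diagonal_instance B) = (\<lambda>_. 1)" "horizon (diagonal_instance B) = B"
  "arrival (diagonal_instance B) = return_pmf" "accept_prob (diagonal_instance B) f t = 1"
  "profit (diagonal_instance B) f t = 1"
  "assignments (diagonal_instance B) = (\<lambda>t. (t, t, 0)) ` {..<B}"
  by (auto simp: diagonal_instance_def assignments_def)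

lemma valid_diagonal_instance: "B > 0 \<Longrightarrow> valid_instance (diagonal_instance B)"
  unfolding valid_instance_def by (auto simp: diagonal_instance_def assignments_def inj_on_def)

lemma total_capacity_diagonal_instance: "total_capacity (diagonal_instance B) = B"
  by (simp add: total_capacity_def)

lemma sum_diagonal_instance:
  assumes "B > 0"
  shows "sum g (assignments (unit_instance (diagonal_instance B))) = (\<Sum>s<B. g ((s, 0), s, 0) :: real)"
  unfolding sum_unit_instance[OF valid_diagonal_instance[OF assms]]
  by (simp add: sum.reindex inj_on_def lessThan_Suc)

lemma lp_diagonal_instance:
  assumes B: "B > 0" and x: "lp_feasible (unit_instance (diagonal_instance B)) x"
    and st: "s < B" "t < B"
  shows "0 \<le> x ((s, 0), s, 0) t" "x ((s, 0), s, 0) t \<le> of_bool (s = t)"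
proof -
  let ?U = "unit_instance (diagonal_instance B)"
  have mem: "((s, 0), s, 0) \<in> assignments ?U"
    using st by (simp add: assignments_unit_instance image_iff)
  show "0 \<le> x ((s, 0), s, 0) t"
    using x mem st by (simp add: lp_feasible_def)
  show "x ((s, 0), s, 0) t \<le> of_bool (s = t)"
    using lp_feasible_le_1(1)[OF valid_unit_instance[OF valid_diagonal_instance[OF B]] x mem, of t] st
    by (auto simp: indicator_def split: if_splits)
qed

text \<open>Tightness is claimed for every optimal solution, so the relevant entries must be
  determined. The value is a sum of \<open>B\<close> entries, each at most 1, and \<open>B\<close>
  is attained by \<open>y\<close>; hence each of them equals 1.\<close>

lemma lp_optimal_diagonal_instance:
  assumes B: "B > 0" and x: "lp_optimal (unit_instance (diagonal_instance B)) x"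
  shows "s < B \<Longrightarrow> t < B \<Longrightarrow> x ((s, 0), s, 0) t = of_bool (s = t)"
    and "lp_value (unit_instance (diagonal_instance B)) x = real B"
proof -
  let ?U = "unit_instance (diagonal_instance B)"
  note valid = valid_diagonal_instance[OF B] and validU = valid_unit_instance[OF valid_diagonal_instance[OF B]]
  have feas: "lp_feasible ?U x" using x by (simp add: lp_optimal_def)
  have val: "lp_value ?U y = (\<Sum>t<B. y ((t, 0), t, 0) t)" if "lp_feasible ?U y" for y
  proof -
    have "(\<Sum>s<B. y ((s, 0), s, 0) t) = (\<Sum>s<B. if s = t then y ((t, 0), t, 0) t else 0)" if "t < B" for t
    proof (intro sum.cong refl)
      fix s assume "s \<in> {..<B}"
      then show "y ((s, 0), s, 0) t = (if s = t then y ((t, 0), t, 0) t else 0)"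
        using lp_diagonal_instance[OF B \<open>lp_feasible ?U y\<close>, of s t] that by auto
    qed
    then show ?thesis
      using B by (simp add: lp_value_def sum_diagonal_instance)
  qed
  define y where "y = (\<lambda>(f :: (nat \<times> nat, nat) assignment) t. of_bool (fst (snd f) = t) :: real)"
  have "lp_feasible ?U y"
    unfolding lp_feasible_def sum_assignments_online[OF validU] sum_assignments_offline[OF validU]
      sum_diagonal_instance[OF B]
    by (auto simp: y_def indicator_def of_bool_def sum.delta cong: if_cong)
  then have "real B \<le> lp_value ?U x"
    using x val[of y] by (auto simp: lp_optimal_def y_def)
  then have sum0: "(\<Sum>t<B. 1 - x ((t, 0), t, 0) t) \<le> 0"
    by (simp add: val[OF feas] sum_subtractf)
  have nn: "0 \<le> 1 - x ((t, 0), t, 0) t" if "t < B" for t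
    using lp_diagonal_instance(2)[OF B feas that that] by simp
  have "(\<Sum>t<B. 1 - x ((t, 0), t, 0) t) = 0"
    using sum0 nn by (intro antisym sum_nonneg) auto
  then have one: "x ((t, 0), t, 0) t = 1" if "t < B" for t
    using nn that by (subst (asm) sum_nonneg_eq_0_iff) auto
  show "lp_value ?U x = real B" using one by (simp add: val[OF feas])
  show "x ((s, 0), s, 0) t = of_bool (s = t)" if "s < B" "t < B"
    using one lp_diagonal_instance[OF B feas that] that by (cases "s = t") auto
qed

lemma variance_diagonal_instance:
  assumes B: "B > 0" and x: "lp_optimal (unit_instance (diagonal_instance B)) x"
    and gamma: "0 \<le> \<gamma>" "\<gamma> \<le> 1/2"
  shows "variance_successes (diagonal_instance B) (ATT (diagonal_instance B) \<gamma> x) = \<gamma> * (1 - \<gamma>) * real B"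
proof -
  interpret att "diagonal_instance B" \<gamma> x
    using valid_diagonal_instance[OF B] x gamma by unfold_locales (auto simp: lp_optimal_def)
  have load: "load u t = of_bool (fst u = t)" if "u \<in> offline U" "t < B" for u t
  proof -
    from that(1) obtain s where s: "u = (s, 0)" "s < B" by (cases u) auto
    have "load u t = (\<Sum>s'<B. if s' = s then x ((s', 0), s', 0) t else 0)"
      using s unfolding load_def sum_assignments_offline[OF validU] sum_diagonal_instance[OF B]
      by (intro sum.cong) auto
    then show ?thesis
      using s that lp_optimal_diagonal_instance(1)[OF B x, of s t] by simp
  qed
  have beta: "\<beta> u T = 1 - \<gamma>" if "u \<in> offline U" for u
  proof -
    have "(\<Sum>t<B. load u t) = (\<Sum>t<B. if fst u = t then 1 else 0)"
      using load[OF that] by (intro sum.cong) auto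
    also have "\<dots> = 1" using that by (auto simp: sum.delta)
    finally show ?thesis by (simp add: beta_load)
  qed
  have off: "(\<Prod>t<T. 1 - (\<Sum>w\<in>{u, v}. rate w t)) = \<beta> u T * \<beta> v T"
    if "u \<in> offline U" "v \<in> offline U" "u \<noteq> v" for u v
  proof -
    have "(\<Prod>t<T. 1 - (\<Sum>w\<in>{u, v}. rate w t)) = (\<Prod>t<T. (1 - rate u t) * (1 - rate v t))"
    proof (intro prod.cong refl)
      fix t assume "t \<in> {..<T}"
      \<comment> \<open>Distinct copies are loaded in distinct rounds, so the mixed term, which was
        the slack of the general bound, vanishes.\<close>
      then have "load u t * load v t = 0" using load that by auto
      then have "rate u t * rate v t = 0" by (auto simp: rate_def)
      then show "1 - (\<Sum>w\<in>{u, v}. rate w t) = (1 - rate u t) * (1 - rate v t)"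
        using \<open>u \<noteq> v\<close> by (simp add: algebra_simps)
    qed
    also have "\<dots> = \<beta> u T * \<beta> v T" by (simp only: prod.distrib prod_rate order_refl)
    finally show ?thesis .
  qed
  have "variance_successes (diagonal_instance B) (ATT (diagonal_instance B) \<gamma> x) =
      (\<Sum>u\<in>offline U. \<Sum>v\<in>offline U. if v = u then \<gamma> * (1 - \<gamma>) else 0)"
    unfolding variance_ATT
  proof (intro sum.cong refl)
    fix u v assume uv: "u \<in> offline U" "v \<in> offline U"
    show "(\<Prod>t<T. 1 - (\<Sum>w\<in>{u, v}. rate w t)) - \<beta> u T * \<beta> v T = (if v = u then \<gamma> * (1 - \<gamma>) else 0)"
      using variance_diagonal[of u] beta[OF uv(1)] off[OF uv] by (cases "u = v") auto
  qed
  also have "\<dots> = \<gamma> * (1 - \<gamma>) * real B"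
    using validU card_offline_unit by (simp add: valid_instance_def total_capacity_diagonal_instance)
  finally show ?thesis .
qed

lemma decision_deterministic:
  assumes "\<And>h. h \<in> set_pmf (play inst \<sigma> \<pi> t) \<Longrightarrow> map_pmf snd (\<pi> h (\<sigma> t)) = return_pmf s"
  shows "decision inst \<sigma> \<pi> t = return_pmf s"
proof -
  have "decision inst \<sigma> \<pi> t = bind_pmf (play inst \<sigma> \<pi> t) (\<lambda>_. return_pmf s)"
    unfolding decision_def by (intro bind_pmf_cong refl assms)
  then show ?thesis by simp
qed

text \<open>Selecting the only assignment earns 1 with certainty, and the LP bound matches. This
  expresses the tightness of the profit against \<open>OPT_OFF\<close> itself.\<close>

lemma OPT_OFF_diagonal_instance:
  assumes x: "lp_optimal (unit_instance (diagonal_instance 1)) x"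
  shows "OPT_OFF (diagonal_instance 1) = 1"
proof -
  let ?I = "diagonal_instance 1"
  define \<pi> :: "(nat, nat) policy" where "\<pi> = (\<lambda>h j. return_pmf (0, Some (j, j, 0)))"
  have valid: "valid_instance ?I" by (rule valid_diagonal_instance) simp
  have \<sigma>: "\<sigma> 0 = 0" if "\<sigma> \<in> set_pmf (arrivals ?I)" for \<sigma>
    using set_arrivals[OF that, of 0] by simp
  have clair: "clairvoyant_policy ?I (\<lambda>_. \<pi>)"
    unfolding clairvoyant_policy_def feasible_on_def
    using \<sigma> by (auto simp: \<pi>_def used_capacity_def assignments_online_def)
  have "measure_pmf.expectation (clairvoyant_outcome ?I (\<lambda>_. \<pi>)) (total_profit ?I) =
      measure_pmf.expectation (arrivals ?I) (\<lambda>\<sigma>. 1)"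
    unfolding expectation_profit_clairvoyant[OF valid clair]
  proof (intro expectation_pmf_cong)
    fix \<sigma> assume s: "\<sigma> \<in> set_pmf (arrivals ?I)"
    have "decision ?I \<sigma> \<pi> 0 = return_pmf (Some (0, 0, 0))"
      by (rule decision_deterministic) (simp add: \<pi>_def \<sigma>[OF s])
    then show "(\<Sum>t<horizon ?I. \<Sum>f\<in>assignments ?I. pmf (decision ?I \<sigma> \<pi> t) (Some f) *
        accept_prob ?I f t * profit ?I f t) = 1"
      by (simp add: lessThan_Suc)
  qed
  then have "1 \<le> OPT_OFF ?I" using clairvoyant_le_OPT_OFF[OF valid clair] by simp
  moreover have "OPT_OFF ?I \<le> 1"
    using OPT_OFF_le_lp[OF valid x] lp_optimal_diagonal_instance(2)[of 1 x] x by simp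
  ultimately show ?thesis by simp
qed

section \<open>The upper barrier 1/2 for online policies\<close>

text \<open>A certain unit profit now against a profit of \<open>1/\<epsilon>\<close> that appears later with probability
  \<open>\<epsilon>\<close>; in the other case the second arrival (again of type 0) is worthless.\<close>

definition gamble_instance :: "real \<Rightarrow> (nat, nat) mpkhd" where
  "gamble_instance \<epsilon> = \<lparr>offline = {0}, online = {0, 1}, edges = {(0, 0), (0, 1)},
     num_prices = 1, price = (\<lambda>_. 0), capacity = (\<lambda>_. 1), horizon = 2,
     arrival = (\<lambda>t. if t = 0 then return_pmf 0 else map_pmf of_bool (bernoulli_pmf \<epsilon>)),
     accept_prob = (\<lambda>_ _. 1),
     profit = (\<lambda>f t. if t = 0 then 1 else if fst (snd f) = 1 then 1 / \<epsilon> else 0)\<rparr>"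

lemma gamble_instance_sel [simp]:
  "capacity (gamble_instance \<epsilon>) = (\<lambda>_. 1)" "horizon (gamble_instance \<epsilon>) = 2"
  "arrival (gamble_instance \<epsilon>) t = (if t = 0 then return_pmf 0 else map_pmf of_bool (bernoulli_pmf \<epsilon>))"
  "accept_prob (gamble_instance \<epsilon>) f t = 1"
  "profit (gamble_instance \<epsilon>) f t = (if t = 0 then 1 else if fst (snd f) = 1 then 1 / \<epsilon> else 0)"
  "assignments (gamble_instance \<epsilon>) = {(0, 0, 0), (0, 1, 0)}"
  by (auto simp: gamble_instance_def assignments_def)

lemma valid_gamble_instance: "0 < \<epsilon> \<Longrightarrow> valid_instance (gamble_instance \<epsilon>)"
  unfolding valid_instance_def by (auto simp: gamble_instance_def assignments_def inj_on_def)

lemma arrivals_gamble_instance: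
  assumes "\<sigma> \<in> set_pmf (arrivals (gamble_instance \<epsilon>))"
  shows "\<sigma> 0 = 0" "\<sigma> 1 = 0 \<or> \<sigma> 1 = 1"
  using set_arrivals[OF assms, of 0] set_arrivals[OF assms, of 1] by auto

lemma expectation_gamble_instance:
  fixes g :: "nat \<Rightarrow> real"
  assumes "0 < \<epsilon>" "\<epsilon> < 1"
  shows "measure_pmf.expectation (arrivals (gamble_instance \<epsilon>)) (\<lambda>\<sigma>. g (\<sigma> 1)) = \<epsilon> * g 1 + (1 - \<epsilon>) * g 0"
proof -
  have "measure_pmf.expectation (arrivals (gamble_instance \<epsilon>)) (\<lambda>\<sigma>. g (\<sigma> 1)) =
     measure_pmf.expectation (map_pmf (\<lambda>\<sigma>. \<sigma> 1) (arrivals (gamble_instance \<epsilon>))) g"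
    by (simp only: integral_map_pmf)
  also have "\<dots> = measure_pmf.expectation (arrival (gamble_instance \<epsilon>) 1) g"
    by (subst map_arrivals) simp_all
  also have "\<dots> = \<epsilon> * g 1 + (1 - \<epsilon>) * g 0"
    using assms by simp
  finally show ?thesis .
qed

text \<open>Foresight takes 1/\<epsilon> when the second type appears and 1 otherwise, which is
  worth \<epsilon> * (1/\<epsilon>) + (1 - \<epsilon>) = 2 - \<epsilon>.\<close>

lemma OPT_OFF_gamble_instance:
  assumes \<epsilon>: "0 < \<epsilon>" "\<epsilon> < 1"
  shows "2 - \<epsilon> \<le> OPT_OFF (gamble_instance \<epsilon>)"
proof -
  let ?I = "gamble_instance \<epsilon>"
  \<comment> \<open>\<open>h = []\<close> recognizes the first round.\<close>
  define \<phi> :: "(nat \<Rightarrow> nat) \<Rightarrow> (nat, nat) policy" where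
    "\<phi> = (\<lambda>\<sigma> h j. return_pmf (0, if h = [] then (if \<sigma> 1 = 1 then None else Some (0, 0, 0))
       else if \<sigma> 1 = 1 then Some (0, 1, 0) else None))"
  have valid: "valid_instance ?I" using \<epsilon>(1) by (rule valid_gamble_instance)
  have clair: "clairvoyant_policy ?I \<phi>"
    unfolding clairvoyant_policy_def feasible_on_def
  proof (intro ballI allI impI)
    fix \<sigma> t h m f
    assume \<sigma>: "\<sigma> \<in> set_pmf (arrivals ?I)" and t: "t < horizon ?I"
      and h: "h \<in> set_pmf (play ?I \<sigma> (\<phi> \<sigma>) t)" and f: "(m, Some f) \<in> set_pmf (\<phi> \<sigma> h (\<sigma> t))"
    consider "t = 0" | "t = Suc 0" using t by force
    then show "f \<in> assignments_online ?I (\<sigma> t) \<and> used_capacity h (fst f) < capacity ?I (fst f)"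
      using h f arrivals_gamble_instance[OF \<sigma>]
      by cases (auto simp: \<phi>_def assignments_online_def used_capacity_def acceptance_def split: if_splits)
  qed
  have "measure_pmf.expectation (clairvoyant_outcome ?I \<phi>) (total_profit ?I) =
      measure_pmf.expectation (arrivals ?I) (\<lambda>\<sigma>. if \<sigma> 1 = 1 then 1 / \<epsilon> else 1)"
    unfolding expectation_profit_clairvoyant[OF valid clair]
  proof (intro expectation_pmf_cong)
    fix \<sigma> assume \<sigma>: "\<sigma> \<in> set_pmf (arrivals ?I)"
    have d0: "decision ?I \<sigma> (\<phi> \<sigma>) 0 = return_pmf (if \<sigma> 1 = 1 then None else Some (0, 0, 0))"
      by (rule decision_deterministic) (simp add: \<phi>_def)
    have d1: "decision ?I \<sigma> (\<phi> \<sigma>) 1 = return_pmf (if \<sigma> 1 = 1 then Some (0, 1, 0) else None)"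
    proof (rule decision_deterministic)
      fix h assume "h \<in> set_pmf (play ?I \<sigma> (\<phi> \<sigma>) 1)"
      then have "length h = 1" by (rule length_play)
      then show "map_pmf snd (\<phi> \<sigma> h (\<sigma> 1)) = return_pmf (if \<sigma> 1 = 1 then Some (0, 1, 0) else None)"
        by (auto simp: \<phi>_def)
    qed
    show "(\<Sum>t<horizon ?I. \<Sum>f\<in>assignments ?I. pmf (decision ?I \<sigma> (\<phi> \<sigma>) t) (Some f) *
        accept_prob ?I f t * profit ?I f t) = (if \<sigma> 1 = 1 then 1 / \<epsilon> else 1)"
      using d0 d1 by (simp add: numeral_2_eq_2 lessThan_Suc)
  qed
  also have "\<dots> = 2 - \<epsilon>"
    using expectation_gamble_instance[OF \<epsilon>, of "\<lambda>j. if j = 1 then 1 / \<epsilon> else 1"] \<epsilon> by simp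
  finally show ?thesis using clairvoyant_le_OPT_OFF[OF valid clair] by simp
qed

text \<open>If the first round is taken with probability s, unit capacity leaves at most 1 - s for
  the second. That round is valuable with probability \<epsilon> and then pays 1/\<epsilon>, so the
  total is at most s + (1 - s).\<close>

lemma expected_profit_gamble_instance:
  assumes \<epsilon>: "0 < \<epsilon>" "\<epsilon> < 1" and online: "online_policy (gamble_instance \<epsilon>) \<pi>"
  shows "expected_profit (gamble_instance \<epsilon>) \<pi> \<le> 1"
proof -
  let ?I = "gamble_instance \<epsilon>"
  have valid: "valid_instance ?I" using \<epsilon>(1) by (rule valid_gamble_instance)
  \<comment> \<open>An online policy faces the empty history and arrival 0 in the first round, so
    \<open>s\<close> is the same for all \<sigma>; for a clairvoyant policy it could vary with
    \<sigma>.\<close>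
  define s where "s = (\<Sum>f\<in>assignments ?I. pmf (map_pmf snd (\<pi> [] 0)) (Some f))"
  have int: "integrable (measure_pmf (arrivals ?I)) g" for g :: "_ \<Rightarrow> real"
    by (intro integrable_measure_pmf_finite finite_set_arrivals valid)
  have clair: "clairvoyant_policy ?I (\<lambda>_. \<pi>)" using online by (simp add: online_policy_eq_clairvoyant)
  have "expected_profit ?I \<pi> \<le> measure_pmf.expectation (arrivals ?I) (\<lambda>\<sigma>. s + of_bool (\<sigma> 1 = 1) * ((1 - s) / \<epsilon>))"
    unfolding expected_profit_def outcome_eq_clairvoyant expectation_profit_clairvoyant[OF valid clair]
  proof (intro expectation_pmf_mono int)
    fix \<sigma> assume \<sigma>: "\<sigma> \<in> set_pmf (arrivals ?I)"
    have feas: "feasible_on ?I \<sigma> \<pi>" using online \<sigma> by (simp add: online_policy_def)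
    let ?d = "\<lambda>f. pmf (decision ?I \<sigma> \<pi> 1) (Some f)"
    have d0: "(\<Sum>f\<in>assignments ?I. pmf (decision ?I \<sigma> \<pi> 0) (Some f)) = s"
      using arrivals_gamble_instance(1)[OF \<sigma>] by (simp add: decision_def s_def bind_return_pmf)
    \<comment> \<open>Acceptance is certain, so selection probabilities are already expected
      capacity usage.\<close>
    have "s + (\<Sum>f\<in>assignments ?I. ?d f) \<le> 1"
      using expected_usage_le[OF valid feas, of 0] by (simp add: numeral_2_eq_2 lessThan_Suc d0[symmetric])
    then have d1: "?d (0, 1, 0) \<le> 1 - s"
      using pmf_nonneg[of "decision ?I \<sigma> \<pi> 1" "Some (0, 0, 0)"] by (simp del: pmf_nonneg)
    have "?d (0, 1, 0) = 0" if "\<sigma> 1 \<noteq> 1"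
      using set_decision[OF feas, of 1 "(0, 1, 0)"] that
      by (auto simp: assignments_online_def set_pmf_iff)
    then have "?d (0, 1, 0) / \<epsilon> \<le> of_bool (\<sigma> 1 = 1) * ((1 - s) / \<epsilon>)"
      using d1 \<epsilon> by (cases "\<sigma> 1 = 1") (auto simp: divide_right_mono)
    then show "(\<Sum>t<horizon ?I. \<Sum>f\<in>assignments ?I. pmf (decision ?I \<sigma> \<pi> t) (Some f) *
        accept_prob ?I f t * profit ?I f t) \<le> s + of_bool (\<sigma> 1 = 1) * ((1 - s) / \<epsilon>)"
      by (simp add: numeral_2_eq_2 lessThan_Suc d0[symmetric])
  qed
  also have "\<dots> = 1"
    using expectation_gamble_instance[OF \<epsilon>, of "\<lambda>j. s + of_bool (j = 1) * ((1 - s) / \<epsilon>)"] \<epsilon>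
    by (simp add: field_simps)
  finally show ?thesis .
qed

lemma no_better_ratio:
  assumes \<rho>: "\<rho> > 1/2"
  shows "\<not> competitive_ratio (A :: (nat, nat) mpkhd \<Rightarrow> (nat, nat) policy) \<rho>"
proof
  assume A: "competitive_ratio A \<rho>"
  \<comment> \<open>Chosen so that \<rho> * (2 - \<epsilon>) = \<rho> + 1/2 > 1; it lies between 0
    and 1 because \<rho> > 1/2.\<close>
  define \<epsilon> where "\<epsilon> = 1 - 1 / (2 * \<rho>)"
  have \<epsilon>: "0 < \<epsilon>" "\<epsilon> < 1" using \<rho> by (simp_all add: \<epsilon>_def field_simps)
  have "online_policy (gamble_instance \<epsilon>) (A (gamble_instance \<epsilon>))"
    and "\<rho> * OPT_OFF (gamble_instance \<epsilon>) \<le> expected_profit (gamble_instance \<epsilon>) (A (gamble_instance \<epsilon>))"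
    using A valid_gamble_instance[OF \<epsilon>(1)] by (auto simp: competitive_ratio_def)
  then have "\<rho> * OPT_OFF (gamble_instance \<epsilon>) \<le> 1"
    using expected_profit_gamble_instance[OF \<epsilon>] by fastforce
  moreover have "\<rho> * (2 - \<epsilon>) \<le> \<rho> * OPT_OFF (gamble_instance \<epsilon>)"
    using OPT_OFF_gamble_instance[OF \<epsilon>] \<rho> by (intro mult_left_mono) auto
  moreover have "\<rho> * (2 - \<epsilon>) = \<rho> + 1/2"
    using \<rho> by (simp add: \<epsilon>_def field_simps)
  ultimately show False using \<rho> by simp
qed

text \<open>\<open>X\<close> is an arbitrary choice of LP optima, so the ratio holds for every way
  of breaking ties.\<close>

lemma competitive_ratio_ATT:
  assumes gamma: "0 \<le> \<gamma>" "\<gamma> \<le> 1/2"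
    and X: "\<And>inst. valid_instance inst \<Longrightarrow> lp_optimal (unit_instance inst) (X inst)"
  shows "competitive_ratio (\<lambda>inst. ATT inst \<gamma> (X inst)) \<gamma>"
  unfolding competitive_ratio_def
proof (intro allI impI)
  fix inst :: "('a, 'b) mpkhd" assume valid: "valid_instance inst"
  interpret att inst \<gamma> "X inst"
    using valid X[OF valid] gamma by unfold_locales (auto simp: lp_optimal_def)
  show "online_policy inst (ATT inst \<gamma> (X inst)) \<and>
        \<gamma> * OPT_OFF inst \<le> expected_profit inst (ATT inst \<gamma> (X inst))"
    using online_policy_ATT OPT_OFF_le_lp[OF valid X[OF valid]] gamma
    by (simp add: expected_profit_ATT mult_left_mono)
qed

text \<open>Existence of LP optima is part of the claim so that the quantifications over optimal
  solutions are not vacuous; likewise \<open>OPT_OFF inst > 0\<close> excludes the trivial equality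
  0 = 0.\<close>

theorem theorem1p2:
  shows
    "(\<forall>inst :: ('i, 'j) mpkhd. valid_instance inst \<longrightarrow>
        (\<exists>x. lp_optimal (unit_instance inst) x))
   \<and> (\<forall>\<gamma>\<in>{0..1/2}. \<forall>X :: ('i, 'j) mpkhd \<Rightarrow> _.
        (\<forall>inst. valid_instance inst \<longrightarrow> lp_optimal (unit_instance inst) (X inst)) \<longrightarrow>
        competitive_ratio (\<lambda>inst. ATT inst \<gamma> (X inst)) \<gamma>)
   \<and> (\<forall>\<gamma>\<in>{0..1/2}. \<forall>inst :: ('i, 'j) mpkhd. \<forall>x.
        valid_instance inst \<longrightarrow> lp_optimal (unit_instance inst) x \<longrightarrow>
        variance_successes inst (ATT inst \<gamma> x) \<le> \<gamma> * (1 - \<gamma>) * real (total_capacity inst))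
   \<and> (\<forall>X :: ('i, 'j) mpkhd \<Rightarrow> _.
        (\<forall>inst. valid_instance inst \<longrightarrow> lp_optimal (unit_instance inst) (X inst)) \<longrightarrow>
        competitive_ratio (\<lambda>inst. ATT inst (1/2) (X inst)) (1/2))
   \<and> (\<forall>\<rho>>1/2. \<nexists>A :: (nat, nat) mpkhd \<Rightarrow> (nat, nat) policy. competitive_ratio A \<rho>)
   \<and> (\<exists>inst :: (nat, nat) mpkhd. valid_instance inst \<and> OPT_OFF inst > 0 \<and>
        (\<forall>\<gamma>\<in>{0..1/2}. \<forall>x. lp_optimal (unit_instance inst) x \<longrightarrow>
           expected_profit inst (ATT inst \<gamma> x) = \<gamma> * OPT_OFF inst))
   \<and> (\<forall>B>0. \<exists>inst :: (nat, nat) mpkhd. valid_instance inst \<and> total_capacity inst = B \<and>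
        (\<forall>\<gamma>\<in>{0..1/2}. \<forall>x. lp_optimal (unit_instance inst) x \<longrightarrow>
           variance_successes inst (ATT inst \<gamma> x) = \<gamma> * (1 - \<gamma>) * real B))"
proof (intro conjI)
  show "\<forall>inst :: ('i, 'j) mpkhd. valid_instance inst \<longrightarrow> (\<exists>x. lp_optimal (unit_instance inst) x)"
    using lp_optimal_exists valid_unit_instance by blast
  show "\<forall>\<gamma>\<in>{0..1/2}. \<forall>X :: ('i, 'j) mpkhd \<Rightarrow> _.
        (\<forall>inst. valid_instance inst \<longrightarrow> lp_optimal (unit_instance inst) (X inst)) \<longrightarrow>
        competitive_ratio (\<lambda>inst. ATT inst \<gamma> (X inst)) \<gamma>"
    by (auto intro: competitive_ratio_ATT)
  show "\<forall>X :: ('i, 'j) mpkhd \<Rightarrow> _.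
        (\<forall>inst. valid_instance inst \<longrightarrow> lp_optimal (unit_instance inst) (X inst)) \<longrightarrow>
        competitive_ratio (\<lambda>inst. ATT inst (1/2) (X inst)) (1/2)"
    by (auto intro: competitive_ratio_ATT)
  show "\<forall>\<gamma>\<in>{0..1/2}. \<forall>inst :: ('i, 'j) mpkhd. \<forall>x.
        valid_instance inst \<longrightarrow> lp_optimal (unit_instance inst) x \<longrightarrow>
        variance_successes inst (ATT inst \<gamma> x) \<le> \<gamma> * (1 - \<gamma>) * real (total_capacity inst)"
    by (auto simp: lp_optimal_def att_def intro!: att.variance_ATT_le)
  show "\<forall>\<rho>>1/2. \<nexists>A :: (nat, nat) mpkhd \<Rightarrow> (nat, nat) policy. competitive_ratio A \<rho>"
    using no_better_ratio by blast
  show "\<forall>B>0. \<exists>inst :: (nat, nat) mpkhd. valid_instance inst \<and> total_capacity inst = B \<and>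
        (\<forall>\<gamma>\<in>{0..1/2}. \<forall>x. lp_optimal (unit_instance inst) x \<longrightarrow>
           variance_successes inst (ATT inst \<gamma> x) = \<gamma> * (1 - \<gamma>) * real B)"
    using valid_diagonal_instance total_capacity_diagonal_instance variance_diagonal_instance
    by (metis atLeastAtMost_iff)
  have valid: "valid_instance (diagonal_instance 1)" by (rule valid_diagonal_instance) simp
  then obtain x where x: "lp_optimal (unit_instance (diagonal_instance 1)) x"
    using lp_optimal_exists valid_unit_instance by blast
  have "expected_profit (diagonal_instance 1) (ATT (diagonal_instance 1) \<gamma> x) = \<gamma> * OPT_OFF (diagonal_instance 1)"
    if "\<gamma> \<in> {0..1/2}" "lp_optimal (unit_instance (diagonal_instance 1)) x" for \<gamma> x
    using att.expected_profit_ATT[of "diagonal_instance 1" \<gamma> x] that valid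
      OPT_OFF_diagonal_instance[OF that(2)] lp_optimal_diagonal_instance(2)[OF _ that(2)]
    by (simp add: att_def lp_optimal_def)
  then show "\<exists>inst :: (nat, nat) mpkhd. valid_instance inst \<and> OPT_OFF inst > 0 \<and>
        (\<forall>\<gamma>\<in>{0..1/2}. \<forall>x. lp_optimal (unit_instance inst) x \<longrightarrow>
           expected_profit inst (ATT inst \<gamma> x) = \<gamma> * OPT_OFF inst)"
    using valid OPT_OFF_diagonal_instance[OF x]
    by (intro exI[of _ "diagonal_instance 1"]) simp
qed

end
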